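(* Let $$M(n):=\frac{\sqrt{2}\,\pi^2}{12\,\nu(n)}I_1(\nu(n)).$$ For every positive integer $n$ with $\nu(n)\geq 43$, $$M(n)\left(1-\frac{1}{\nu(n)^6}\right)\leq q(n)\leq M(n)\left(1+\frac{1}{\nu(n)^6}\right).$$
   Context: For an integer $n\ge 0$, $q(n)$ is the number of partitions of $n$ into distinct parts, with generating function $\sum_{n\ge 0}q(n)x^n=\prod_{j=1}^{\infty}(1+x^j)$. Define $$\nu(n)=\frac{\pi\sqrt{24n+1}}{6\sqrt{2}}.$$ $I_1(s)$ is the first modified Bessel function of the first kind, $$I_1(s)=\frac{s}{\pi}\int_{-1}^1(1-t^2)^{\frac{1}{2}}e^{st}\,\mathrm{d}t.$$ *)

theory Defs
  imports "HOL-Analysis.Analysis"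
begin

text \<open>A partition into distinct parts has no repeated part, so it is the same thing as the finite
  set of its parts, which are positive integers. The empty set gives \<open>q 0 = 1\<close>.\<close>

definition distinct_partitions :: "nat \<Rightarrow> nat set set" where
  "distinct_partitions n = {P. finite P \<and> (\<forall>p\<in>P. 0 < p) \<and> \<Sum>P = n}"

text \<open>Cardinality of an infinite set would be \<open>0\<close>; this does not occur here.\<close>

lemma finite_distinct_partitions: "finite (distinct_partitions n)"
proof (rule finite_subset)
  show "distinct_partitions n \<subseteq> Pow {..n}"
    by (auto simp: distinct_partitions_def intro: member_le_sum[where f = "\<lambda>x. x"])
qed simp

definition q :: "nat \<Rightarrow> nat" where
  "q n = card (distinct_partitions n)"

definition nu :: "nat \<Rightarrow> real" where
  "nu n = pi * sqrt (24 * real n + 1) / (6 * sqrt 2)"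

definition bessel_I1 :: "real \<Rightarrow> real" where
  "bessel_I1 s = s / pi * integral {-1..1} (\<lambda>t. sqrt (1 - t\<^sup>2) * exp (s * t))"

definition M :: "nat \<Rightarrow> real" where
  "M n = sqrt 2 * pi\<^sup>2 / (12 * nu n) * bessel_I1 (nu n)"

end

theory Submission
  imports Defs "HOL-Complex_Analysis.Complex_Analysis"
begin

text \<open>By Cauchy's formula, \<open>q(n)\<close> is the integral of \<open>F(e\<^sup>-\<^sup>2\<^sup>\<pi>\<^sup>z) e\<^sup>2\<^sup>\<pi>\<^sup>n\<^sup>z\<close> over the segment \<open>z = \<delta> + ix\<close>,
  \<open>\<bar>x\<bar> \<le> 1/2\<close>, where \<open>F\<close> is the generating function. The transformation formula
  \<open>F(e\<^sup>-\<^sup>2\<^sup>\<pi>\<^sup>z) F(e\<^sup>-\<^sup>\<pi>\<^sup>/\<^sup>z) = exp(\<pi>/(24z) + \<pi>z/12) / \<surd>2\<close> suggests to replace \<open>F(e\<^sup>-\<^sup>2\<^sup>\<pi>\<^sup>z)\<close> by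
  \<open>exp(\<pi>/(24z) + \<pi>z/12) / \<surd>2\<close>; completing the segment to a rectangle around the origin then yields
  the Bessel function, up to a small error. The formula also says that the absolute value of the
  Weber function \<open>\<surd>2 e\<^sup>-\<^sup>\<pi>\<^sup>z\<^sup>/\<^sup>1\<^sup>2 F(e\<^sup>-\<^sup>2\<^sup>\<pi>\<^sup>z)\<close> is inverted, up to a constant, by the Fricke involution
  of level 2. Reduction theory for the group generated by this involution and \<open>\<Gamma>\<^sub>0(2)\<close> therefore bounds
  \<open>F\<close> away from \<open>x = 0\<close>: the worst cusps are \<open>x = \<plusminus>1/3\<close>, where \<open>F\<close> is of size \<open>exp(\<pi>/(216\<delta>))\<close>.
  The choice \<open>\<delta> = \<pi>/(36\<nu>)\<close> makes the total error of order \<open>e\<^sup>\<nu>\<^sup>/\<^sup>3\<close>.\<close>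

subsection \<open>The generating function\<close>

definition distinct_gf :: "'a \<Rightarrow> 'a :: {banach, real_normed_field}" where
  "distinct_gf x = (\<Sum>n. of_nat (q n) * x ^ n)"

lemma prod_one_plus_power_eq_sum_Pow:
  fixes x :: "'a :: comm_semiring_1"
  shows "(\<Prod>j\<in>{1..N}. 1 + x ^ j) = (\<Sum>P\<in>Pow {1..N}. x ^ (\<Sum>P))"
proof -
  have "(\<Prod>j\<in>{1..N}. x ^ j + 1) = (\<Sum>P\<in>Pow {1..N}. (\<Prod>j\<in>P. x ^ j) * (\<Prod>j\<in>{1..N}-P. 1))"
    by (rule prod_add) auto
  also have "\<dots> = (\<Sum>P\<in>Pow {1..N}. x ^ (\<Sum>P))"
    by (simp add: power_sum)
  finally show ?thesis by (simp add: add.commute)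
qed

lemma sum_q_eq_sum_UN:
  fixes x :: real
  shows "(\<Sum>n\<le>N. real (q n) * x ^ n) = (\<Sum>P\<in>(\<Union>n\<le>N. distinct_partitions n). x ^ (\<Sum>P))"
proof -
  have "(\<Sum>P\<in>(\<Union>n\<le>N. distinct_partitions n). x ^ (\<Sum>P)) =
        (\<Sum>n\<le>N. \<Sum>P\<in>distinct_partitions n. x ^ (\<Sum>P))"
    by (rule sum.UNION_disjoint)
       (simp_all add: finite_distinct_partitions, auto simp: distinct_partitions_def)
  also have "\<dots> = (\<Sum>n\<le>N. \<Sum>P\<in>distinct_partitions n. x ^ n)"
    by (intro sum.cong) (auto simp: distinct_partitions_def)
  also have "\<dots> = (\<Sum>n\<le>N. real (q n) * x ^ n)"
    by (simp add: q_def)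
  finally show ?thesis by simp
qed

text \<open>Parts of a partition of n \<le> N are at most N, so its term occurs in the expanded
  product, whose remaining terms are nonnegative.\<close>

lemma sum_q_le_prod:
  fixes x :: real
  assumes "0 \<le> x"
  shows "(\<Sum>n\<le>N. real (q n) * x ^ n) \<le> (\<Prod>j\<in>{1..N}. 1 + x ^ j)"
  unfolding sum_q_eq_sum_UN prod_one_plus_power_eq_sum_Pow
proof (rule sum_mono2)
  show "(\<Union>n\<le>N. distinct_partitions n) \<subseteq> Pow {1..N}"
  proof clarify
    fix n P p assume *: "n \<le> N" "P \<in> distinct_partitions n" "p \<in> P"
    hence "p \<le> \<Sum>P"
      by (intro member_le_sum[where f = "\<lambda>x. x"]) (auto simp: distinct_partitions_def)
    with * show "p \<in> {1..N}"
      by (auto simp: distinct_partitions_def Suc_le_eq)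
  qed
qed (use assms in auto)

text \<open>Every subset of \<open>{1..N}\<close> is a distinct partition of its own sum. With
  \<open>sum_q_le_prod\<close> this squeezes the partial products between partial sums of the power
  series.\<close>

lemma prod_le_sum_q:
  fixes x :: real
  assumes "0 \<le> x"
  shows "(\<Prod>j\<in>{1..N}. 1 + x ^ j) \<le> (\<Sum>n\<le>\<Sum>{1..N}. real (q n) * x ^ n)"
  unfolding sum_q_eq_sum_UN prod_one_plus_power_eq_sum_Pow
proof (rule sum_mono2)
  show "Pow {1..N} \<subseteq> (\<Union>n\<le>\<Sum>{1..N}. distinct_partitions n)"
  proof
    fix P assume "P \<in> Pow {1..N}"
    hence P: "P \<subseteq> {1..N}" by simp
    hence "\<Sum>P \<le> \<Sum>{1..N}" by (intro sum_mono2) auto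
    moreover have "finite P" using P by (rule finite_subset) simp
    moreover have "\<forall>p\<in>P. 0 < p" using P by auto
    ultimately show "P \<in> (\<Union>n\<le>\<Sum>{1..N}. distinct_partitions n)"
      by (auto simp: distinct_partitions_def)
  qed
qed (use assms in \<open>auto simp: finite_distinct_partitions\<close>)

lemma prod_one_plus_power_le:
  fixes x :: real
  assumes "0 \<le> x" "x < 1"
  shows "(\<Prod>j\<in>{1..N}. 1 + x ^ j) \<le> exp (x / (1 - x))"
proof -
  have "(\<Prod>j\<in>{1..N}. 1 + x ^ j) \<le> (\<Prod>j\<in>{1..N}. exp (x ^ j))"
    using assms by (intro prod_mono) (auto intro: add_nonneg_nonneg exp_ge_add_one_self)
  also have "\<dots> = exp (\<Sum>j\<in>{1..N}. x ^ j)"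
    by (simp add: exp_sum)
  also have "(\<Sum>j\<in>{1..N}. x ^ j) \<le> (\<Sum>j. x ^ Suc j)"
  proof -
    have "(\<Sum>j\<in>{1..N}. x ^ j) = (\<Sum>j<N. x ^ Suc j)"
      by (rule sum.reindex_bij_witness[of _ Suc "\<lambda>j. j - 1"]) auto
    also have "\<dots> \<le> (\<Sum>j. x ^ Suc j)"
      using assms by (intro sum_le_suminf summable_mult) (auto intro!: summable_geometric summable_mult)
    finally show ?thesis .
  qed
  also have "(\<Sum>j. x ^ Suc j) = x / (1 - x)"
    using assms suminf_mult[of "\<lambda>j. x ^ j" x] by (simp add: suminf_geometric summable_geometric)
  finally show ?thesis by simp
qed

lemma sum_q_le_exp:
  fixes x :: real
  assumes "0 \<le> x" "x < 1"
  shows "(\<Sum>n<N. real (q n) * x ^ n) \<le> exp (x / (1 - x))"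
proof -
  have "(\<Sum>n<N. real (q n) * x ^ n) \<le> (\<Sum>n\<le>N. real (q n) * x ^ n)"
    using assms by (intro sum_mono2) auto
  thus ?thesis
    using sum_q_le_prod[of x N] prod_one_plus_power_le[OF assms, of N] assms by linarith
qed

lemma summable_q_real:
  fixes x :: real
  assumes "0 \<le> x" "x < 1"
  shows "summable (\<lambda>n. real (q n) * x ^ n)"
  by (rule summableI_nonneg_bounded[where x = "exp (x / (1 - x))"])
     (use assms sum_q_le_exp[OF assms] in auto)

lemma distinct_gf_le_exp:
  fixes x :: real
  assumes "0 \<le> x" "x < 1"
  shows "distinct_gf x \<le> exp (x / (1 - x))"
  unfolding distinct_gf_def using sum_q_le_exp[OF assms] summable_q_real[OF assms]
  by (intro suminf_le_const) auto

lemma distinct_gf_prod_LIMSEQ: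
  fixes x :: real
  assumes "0 \<le> x" "x < 1"
  shows "(\<lambda>N. \<Prod>j\<in>{1..N}. 1 + x ^ j) \<longlonglongrightarrow> distinct_gf x"
proof (rule tendsto_sandwich)
  show "eventually (\<lambda>N. (\<Sum>n\<le>N. real (q n) * x ^ n) \<le> (\<Prod>j\<in>{1..N}. 1 + x ^ j)) sequentially"
    using sum_q_le_prod[OF assms(1)] by simp
  have "(\<Prod>j\<in>{1..N}. 1 + x ^ j) \<le> distinct_gf x" for N
  proof -
    have "(\<Sum>n\<le>\<Sum>{1..N}. real (q n) * x ^ n) \<le> distinct_gf x"
      unfolding distinct_gf_def of_nat_id
      using assms by (intro sum_le_suminf summable_q_real) auto
    with prod_le_sum_q[OF assms(1), of N] show ?thesis by linarith
  qed
  thus "eventually (\<lambda>N. (\<Prod>j\<in>{1..N}. 1 + x ^ j) \<le> distinct_gf x) sequentially" by simp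
  show "(\<lambda>N. \<Sum>n\<le>N. real (q n) * x ^ n) \<longlonglongrightarrow> distinct_gf x"
    unfolding distinct_gf_def
    using summable_LIMSEQ'[OF summable_q_real[OF assms]] by simp
qed auto

lemma summable_norm_q:
  fixes x :: "'a :: {banach, real_normed_field}"
  assumes "norm x < 1"
  shows "summable (\<lambda>n. norm (of_nat (q n) * x ^ n))"
  using summable_q_real[of "norm x"] assms by (simp add: norm_mult norm_power)

lemma q_0: "q 0 = 1"
proof -
  have "P = {}" if "P \<in> distinct_partitions 0" for P
  proof -
    from that have "finite P" "\<forall>p\<in>P. 0 < p" "(\<Sum>p\<in>P. p) = 0"
      by (auto simp: distinct_partitions_def)
    moreover from this have "\<forall>p\<in>P. p = 0" by (simp only: sum_eq_0_iff)
    ultimately show "P = {}" by fastforce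
  qed
  moreover have "{} \<in> distinct_partitions 0" by (simp add: distinct_partitions_def)
  ultimately have "distinct_partitions 0 = {{}}" by blast
  thus ?thesis by (simp add: q_def)
qed

lemma distinct_gf_ge_1:
  fixes x :: real
  assumes "0 \<le> x" "x < 1"
  shows "1 \<le> distinct_gf x"
  unfolding distinct_gf_def
  using sum_le_suminf[OF summable_q_real[OF assms], of "{0}"] assms q_0 by simp

text \<open>The coefficients are nonnegative and the constant one is 1, so the tail is dominated
  termwise. Complex estimates thereby reduce to real arguments.\<close>

lemma norm_distinct_gf_minus_1_le:
  fixes x :: "'a :: {banach, real_normed_field}"
  assumes "norm x < 1"
  shows "norm (distinct_gf x - 1) \<le> distinct_gf (norm x) - 1"
proof -
  have s: "summable (\<lambda>n. norm (of_nat (q n) * x ^ n))" by (rule summable_norm_q) fact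
  have "distinct_gf x - 1 = (\<Sum>n. of_nat (q (Suc n)) * x ^ Suc n)"
    unfolding distinct_gf_def using suminf_split_head[OF summable_norm_cancel[OF s]] by (simp add: q_0)
  also have "norm \<dots> \<le> (\<Sum>n. norm (of_nat (q (Suc n)) * x ^ Suc n))"
    using s by (intro summable_norm) (subst summable_Suc_iff)
  also have "\<dots> = distinct_gf (norm x) - 1"
    unfolding distinct_gf_def using suminf_split_head[OF s] by (simp add: q_0 norm_mult norm_power)
  finally show ?thesis .
qed

lemma distinct_gf_of_real:
  assumes "\<bar>x\<bar> < 1"
  shows "distinct_gf (of_real x :: complex) = of_real (distinct_gf x)"
proof -
  have "summable (\<lambda>n. real (q n) * x ^ n)"
    using summable_norm_q[of x] assms by (auto intro: summable_norm_cancel)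
  from suminf_of_real[OF this, where 'a = complex] show ?thesis by (simp add: distinct_gf_def)
qed

lemma holomorphic_distinct_gf: "distinct_gf holomorphic_on ball (0 :: complex) 1"
proof (rule power_series_holomorphic)
  fix w :: complex assume "w \<in> ball 0 1"
  hence "summable (\<lambda>n. of_nat (q n) * w ^ n)"
    by (intro summable_norm_cancel[OF summable_norm_q]) auto
  thus "(\<lambda>n. of_nat (q n) * (w - 0) ^ n) sums distinct_gf w"
    by (simp add: distinct_gf_def summable_sums)
qed

text \<open>Fubini for iterated series: absolute convergence in one order gives an unordered sum
  over all pairs, which can then be evaluated in the other order.\<close>

lemma sums_swap:
  fixes f :: "nat \<Rightarrow> nat \<Rightarrow> real"
  assumes abs: "\<And>k. (\<lambda>l. \<bar>f l k\<bar>) sums B' k" and B': "summable B'"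
    and B: "\<And>k. (\<lambda>l. f l k) sums B k" and A: "\<And>l. (\<lambda>k. f l k) sums A l"
    and S: "B sums S"
  shows "A sums S"
proof -
  have abs': "((\<lambda>l. \<bar>f l k\<bar>) has_sum B' k) UNIV" for k
    using abs by (intro sums_nonneg_imp_has_sum) auto
  have B'_nonneg: "B' k \<ge> 0" for k
    using abs' by (rule has_sum_nonneg) auto
  have "(\<lambda>(k, l). \<bar>f l k\<bar>) summable_on (UNIV \<times> UNIV)"
  proof (rule summable_on_SigmaI)
    show "((\<lambda>l. case (k, l) of (k, l) \<Rightarrow> \<bar>f l k\<bar>) has_sum B' k) UNIV" for k
      using abs' by simp
    show "B' summable_on UNIV"
      using B' B'_nonneg by (rule summable_nonneg_imp_summable_on)
  qed auto
  hence "(\<lambda>x. norm (case x of (k, l) \<Rightarrow> f l k)) summable_on (UNIV \<times> UNIV)"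
    by (simp add: case_prod_unfold)
  hence summ: "(\<lambda>(k, l). f l k) summable_on (UNIV \<times> UNIV)"
    by (rule abs_summable_summable)
  define T where "T = infsum (\<lambda>(k, l). f l k) (UNIV \<times> UNIV)"
  have T: "((\<lambda>(k, l). f l k) has_sum T) (UNIV \<times> UNIV)"
    using summ unfolding T_def by (rule has_sum_infsum)
  have "((\<lambda>l. f l k) has_sum B k) UNIV" for k
    using abs B by (intro norm_summable_imp_has_sum) (auto simp: sums_iff)
  hence "(B has_sum T) UNIV"
    using T by (intro has_sum_SigmaD[OF T]) auto
  hence "T = S" using S has_sum_imp_sums sums_unique2 by blast
  have T': "((\<lambda>(l, k). f l k) has_sum T) (UNIV \<times> UNIV)"
    using T by (subst has_sum_swap) (simp add: case_prod_unfold)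
  have "((\<lambda>k. f l k) has_sum A l) UNIV" for l
  proof -
    have "(\<lambda>k. f l k) summable_on UNIV"
      by (rule summable_on_SigmaD1[where A = UNIV and B = "\<lambda>_. UNIV"])
         (use has_sum_imp_summable[OF T'] in auto)
    then obtain a where "((\<lambda>k. f l k) has_sum a) UNIV" by (auto simp: summable_on_def)
    with A[of l] show ?thesis using has_sum_imp_sums sums_unique2 by blast
  qed
  hence "(A has_sum T) UNIV"
    by (intro has_sum_SigmaD[OF T']) auto
  thus ?thesis using \<open>T = S\<close> has_sum_imp_sums by blast
qed

subsection \<open>The partial fraction expansion of the hyperbolic cotangent\<close>

text \<open>By the reflection formula of the Gamma function \<open>?g\<close> is constant off the
  integers, so its derivative vanishes there.\<close>

lemma Digamma_reflection_complex:
  fixes z :: complex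
  assumes "z \<notin> \<int>"
  shows "Digamma (1 - z) - Digamma z = pi * cos (pi * z) / sin (pi * z)"
proof -
  let ?g = "\<lambda>w. Gamma w * Gamma (1 - w) * sin (of_real pi * w)"
  have z': "1 - z \<notin> \<int>"
    using assms by (metis Ints_1 Ints_diff diff_diff_eq2 add_diff_cancel_left')
  have sin_nz: "sin (of_real pi * w) \<noteq> 0" if "w \<notin> \<int>" for w :: complex
    using that by (auto simp: sin_eq_0 mult.commute[of _ "of_real pi"])
  have nonpos: "z \<notin> \<int>\<^sub>\<le>\<^sub>0" "1 - z \<notin> \<int>\<^sub>\<le>\<^sub>0"
    using assms z' by (auto dest: nonpos_Ints_Int)
  have "(?g has_field_derivative
          (Gamma z * Gamma (1 - z) * (Digamma z - Digamma (1 - z)) * sin (of_real pi * z) +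
           Gamma z * Gamma (1 - z) * (of_real pi * cos (of_real pi * z)))) (at z)"
    using nonpos by (auto intro!: derivative_eq_intros simp: algebra_simps)
  moreover have "(?g has_field_derivative 0) (at z)"
  proof (rule has_field_derivative_transform_within_open)
    show "((\<lambda>_. complex_of_real pi) has_field_derivative 0) (at z)" by simp
    show "open (- \<int> :: complex set)" by (simp add: open_Compl closed_Ints)
    show "z \<in> - \<int>" using assms by simp
    fix w :: complex assume "w \<in> - \<int>"
    thus "of_real pi = ?g w" using sin_nz[of w] by (simp add: Gamma_reflection_complex)
  qed
  ultimately have "Gamma z * Gamma (1 - z) * (Digamma z - Digamma (1 - z)) * sin (of_real pi * z) +
           Gamma z * Gamma (1 - z) * (of_real pi * cos (of_real pi * z)) = 0"
    by (rule DERIV_unique)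
  hence "Gamma z * Gamma (1 - z) *
      ((Digamma z - Digamma (1 - z)) * sin (of_real pi * z) + of_real pi * cos (of_real pi * z)) = 0"
    by (simp add: algebra_simps)
  moreover have "Gamma z * Gamma (1 - z) \<noteq> 0"
    using nonpos by (simp add: Gamma_eq_zero_iff)
  ultimately have "(Digamma z - Digamma (1 - z)) * sin (of_real pi * z) + of_real pi * cos (of_real pi * z) = 0"
    by simp
  hence "of_real pi * cos (of_real pi * z) = (Digamma (1 - z) - Digamma z) * sin (of_real pi * z)"
    by (simp add: algebra_simps)
  thus ?thesis using sin_nz[OF assms] by (simp add: field_simps)
qed

text \<open>The Digamma series at \<open>1 - z\<close> and \<open>1 + z\<close>, z = iy, differ by
  this series times -2iy, and the reflection formula evaluates the difference. The value \<pi>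
  coth(\<pi> y) / (2y) - 1 / (2y^2) is written with the Lambert term 1 / (exp(2 \<pi> y) - 1) that
  occurs in the logarithm of the generating function.\<close>

lemma coth_partial_fractions:
  fixes y :: real
  assumes y: "y > 0"
  shows "(\<lambda>k. 1 / (y\<^sup>2 + (real (Suc k))\<^sup>2)) sums
           (pi / y * (1 / (exp (2 * pi * y) - 1) + 1 / 2 - 1 / (2 * pi * y)))"
proof -
  define z where "z = \<i> * complex_of_real y"
  have z: "z \<notin> \<int>" "z \<noteq> 0" "1 - z \<noteq> 0" "1 + z \<noteq> 0"
    using y by (auto simp: z_def complex_eq_iff complex_is_Int_iff)
  have "(\<lambda>n. inverse (of_nat (Suc n)) - inverse (w + of_nat n)) sums (Digamma w + euler_mascheroni)"
    if "w \<noteq> 0" for w :: complex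
    using summable_sums[OF summable_Digamma[OF that]] by (simp add: Digamma_def)
  from sums_diff[OF this[OF z(3)] this[OF z(4)]]
  have "(\<lambda>n. inverse (1 + z + of_nat n) - inverse (1 - z + of_nat n)) sums (Digamma (1 - z) - Digamma (1 + z))"
    by (simp add: algebra_simps)
  also have "Digamma (1 + z) = Digamma z + 1 / z"
    using Digamma_plus1[of z] z by (simp add: add.commute)
  also have "Digamma (1 - z) - (Digamma z + 1 / z) = pi * cos (pi * z) / sin (pi * z) - 1 / z"
    using Digamma_reflection_complex[of z] z by simp
  also have "(\<lambda>n. inverse (1 + z + of_nat n) - inverse (1 - z + of_nat n)) =
             (\<lambda>n. (-2 * \<i> * of_real y) * of_real (1 / (y\<^sup>2 + (real (Suc n))\<^sup>2)))"
  proof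
    fix n :: nat
    have nz: "1 + z + of_nat n \<noteq> 0" "1 - z + of_nat n \<noteq> 0" "(of_nat (Suc n))\<^sup>2 + (of_real y :: complex)\<^sup>2 \<noteq> 0"
    proof -
      show "1 + z + of_nat n \<noteq> 0" "1 - z + of_nat n \<noteq> 0"
        using y by (auto simp: z_def complex_eq_iff)
      have "(real (Suc n))\<^sup>2 + y\<^sup>2 \<noteq> 0" using y by (simp add: add_nonneg_eq_0_iff)
      hence "complex_of_real ((real (Suc n))\<^sup>2 + y\<^sup>2) \<noteq> 0" by (subst of_real_eq_0_iff)
      thus "(of_nat (Suc n))\<^sup>2 + (of_real y :: complex)\<^sup>2 \<noteq> 0" by simp
    qed
    have zz: "(1 + z + of_nat n) * (1 - z + of_nat n) = (of_nat (Suc n))\<^sup>2 + (of_real y)\<^sup>2"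
      by (simp add: z_def power2_eq_square algebra_simps)
    have "inverse (1 + z + of_nat n) - inverse (1 - z + of_nat n) =
            (-2 * z) / ((1 + z + of_nat n) * (1 - z + of_nat n))"
      using nz by (simp add: field_simps)
    also have "\<dots> = (-2 * \<i> * of_real y) * of_real (1 / (y\<^sup>2 + (real (Suc n))\<^sup>2))"
      unfolding zz by (simp add: z_def add.commute)
    finally show "inverse (1 + z + of_nat n) - inverse (1 - z + of_nat n) =
             (-2 * \<i> * of_real y) * of_real (1 / (y\<^sup>2 + (real (Suc n))\<^sup>2))" .
  qed
  finally have s: "(\<lambda>n. (-2 * \<i> * of_real y) * of_real (1 / (y\<^sup>2 + (real (Suc n))\<^sup>2))) sums
                (pi * cos (pi * z) / sin (pi * z) - 1 / z)" .
  have cotz: "pi * cos (pi * z) / sin (pi * z) - 1 / z =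
     (-2 * \<i> * of_real y) * of_real (pi / y * (1 / (exp (2 * pi * y) - 1) + 1 / 2 - 1 / (2 * pi * y)))"
  proof -
    define E where "E = exp (pi * y)"
    have E: "E > 1" using y by (simp add: E_def)
    hence EE: "E * E > 1" using less_1_mult by blast
    have e: "exp (\<i> * (pi * z)) = of_real (1 / E)" "exp (-(\<i> * (pi * z))) = of_real E"
      by (simp_all add: z_def E_def exp_of_real[symmetric] exp_minus field_simps)
    have cs: "cos (pi * z) = of_real ((1 / E + E) / 2)" "sin (pi * z) = \<i> * of_real ((E - 1 / E) / 2)"
      by (simp_all add: cos_exp_eq sin_exp_eq' e)
    have "pi * cos (pi * z) / sin (pi * z) = -\<i> * of_real (pi * ((1 / E + E) / (E - 1 / E)))"
    proof -
      have "of_real pi * of_real (A / 2) / (\<i> * of_real (B / 2)) = -\<i> * of_real (pi * (A / B))"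
        if "B \<noteq> 0" for A B :: real
        using that by (simp add: field_simps)
      moreover have "E - 1 / E \<noteq> 0" using E EE by (simp add: field_simps)
      ultimately show ?thesis unfolding cs by blast
    qed
    also have "(1 / E + E) / (E - 1 / E) = 1 + 2 / (E * E - 1)"
      using E EE by (simp add: field_simps)
    also have "E * E = exp (2 * pi * y)"
      by (simp add: E_def exp_add[symmetric])
    finally have c: "pi * cos (pi * z) / sin (pi * z) = -\<i> * of_real (pi * (1 + 2 / (exp (2 * pi * y) - 1)))" .
    have zi: "1 / z = - (\<i> * of_real (1 / y))" using y by (simp add: z_def field_simps)
    have "pi * cos (pi * z) / sin (pi * z) - 1 / z =
       -\<i> * of_real (pi * (1 + 2 / (exp (2 * pi * y) - 1))) + \<i> * of_real (1 / y)"
      unfolding c zi by simp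
    also have "\<dots> = (-2 * \<i> * of_real y) *
       of_real (pi / y * (1 / (exp (2 * pi * y) - 1) + 1 / 2 - 1 / (2 * pi * y)))"
      using y EE by (simp add: complex_eq_iff field_simps)
    finally show ?thesis .
  qed
  have "-2 * \<i> * of_real y \<noteq> 0" using y by simp
  hence "(\<lambda>n. complex_of_real (1 / (y\<^sup>2 + (real (Suc n))\<^sup>2))) sums
     of_real (pi / y * (1 / (exp (2 * pi * y) - 1) + 1 / 2 - 1 / (2 * pi * y)))"
    using s unfolding cotz by (subst (asm) sums_mult_iff)
  thus ?thesis by (simp only: sums_of_real_iff)
qed


subsection \<open>The logarithm of the generating function\<close>

lemma ln_one_minus_sums:
  fixes x :: real
  assumes "0 \<le> x" "x < 1"
  shows "(\<lambda>m. x ^ Suc m / real (Suc m)) sums (- ln (1 - x))"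
proof -
  have "(\<lambda>n. - (x ^ n / real n)) sums ln (1 - x)"
    using ln_series'[of "-x"] assms by simp
  hence "(\<lambda>n. x ^ n / real n) sums (- ln (1 - x))"
    using sums_minus by fastforce
  thus ?thesis
    by (subst sums_Suc_iff[of "\<lambda>n. x ^ n / real n"]) simp
qed

lemma ln_one_plus_sums:
  fixes x :: real
  assumes "0 \<le> x" "x < 1"
  shows "(\<lambda>m. (-1) ^ m * (x ^ Suc m / real (Suc m))) sums ln (1 + x)"
proof -
  have "(\<lambda>n. - ((-x) ^ n / real n)) sums ln (1 + x)"
    using ln_series'[of x] assms by simp
  hence "(\<lambda>m. - ((-x) ^ Suc m / real (Suc m))) sums ln (1 + x)"
    by (subst sums_Suc_iff[of "\<lambda>n. - ((-x) ^ n / real n)"]) simp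
  also have "(\<lambda>m. - ((-x) ^ Suc m / real (Suc m))) = (\<lambda>m. (-1) ^ m * (x ^ Suc m / real (Suc m)))"
    by (simp add: power_minus[of x] fun_eq_iff)
  finally show ?thesis .
qed

lemma minus_ln_one_minus_le:
  fixes x y :: real
  assumes "0 \<le> x" "x \<le> y" "y < 1"
  shows "- ln (1 - x) \<le> x / (1 - y)"
proof -
  have "- ln (1 - x) = ln (1 / (1 - x))" using assms by (simp add: ln_div)
  also have "\<dots> \<le> 1 / (1 - x) - 1" using assms by (intro ln_le_minus_one) auto
  also have "\<dots> = x / (1 - x)" using assms by (simp add: field_simps)
  also have "\<dots> \<le> x / (1 - y)" using assms by (intro divide_left_mono mult_pos_pos) auto
  finally show ?thesis .
qed

lemma summable_ln_one_minus_power: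
  fixes x :: real
  assumes "0 \<le> x" "x < 1"
  shows "summable (\<lambda>j. - ln (1 - x ^ Suc j))"
proof (rule summable_comparison_test')
  show "summable (\<lambda>j. x ^ Suc j / (1 - x))"
    using assms by (intro summable_divide) (simp add: summable_geometric summable_mult)
  fix j :: nat
  have "x ^ Suc j \<le> x" "0 \<le> x ^ Suc j"
    using assms power_decreasing[of 1 "Suc j" x] by auto
  moreover from this have "ln (1 - x ^ Suc j) \<le> 0" using assms by simp
  ultimately show "norm (- ln (1 - x ^ Suc j)) \<le> x ^ Suc j / (1 - x)"
    using minus_ln_one_minus_le[of "x ^ Suc j" x] assms by simp
qed

lemma ln_distinct_gf_sums:
  fixes x :: real
  assumes "0 \<le> x" "x < 1"
  shows "(\<lambda>j. ln (1 + x ^ Suc j)) sums ln (distinct_gf x)"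
proof -
  have "(\<lambda>N. ln (\<Prod>j\<in>{1..N}. 1 + x ^ j)) \<longlonglongrightarrow> ln (distinct_gf x)"
    using distinct_gf_ge_1[OF assms]
    by (intro tendsto_ln distinct_gf_prod_LIMSEQ assms) auto
  also have "(\<lambda>N. ln (\<Prod>j\<in>{1..N}. 1 + x ^ j)) = (\<lambda>N. \<Sum>j<N. ln (1 + x ^ Suc j))"
  proof
    fix N
    have pos: "1 + x ^ j > 0" for j using assms by (simp add: add_pos_nonneg)
    have "ln (\<Prod>j\<in>{1..N}. 1 + x ^ j) = (\<Sum>j\<in>{1..N}. ln (1 + x ^ j))"
      using pos by (intro ln_prod) (auto simp: less_imp_neq[symmetric])
    also have "\<dots> = (\<Sum>j<N. ln (1 + x ^ Suc j))"
      by (rule sum.reindex_bij_witness[of _ Suc "\<lambda>j. j - 1"]) auto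
    finally show "ln (\<Prod>j\<in>{1..N}. 1 + x ^ j) = (\<Sum>j<N. ln (1 + x ^ Suc j))" .
  qed
  finally show ?thesis by (simp add: sums_def)
qed

lemma geometric_sums_Suc:
  fixes y :: real
  assumes "0 \<le> y" "y < 1"
  shows "(\<lambda>j. y ^ Suc j) sums (y / (1 - y))"
  using sums_mult[OF geometric_sums[of y], of y] assms by simp

text \<open>Expand each \<open>ln (1 + x ^ Suc k)\<close> in powers and sum over k first, a
  geometric series. The interchange is legitimate because the absolute values add up to
  \<open>- ln (1 - x ^ Suc k)\<close>, which is summable in k.\<close>

lemma ln_distinct_gf_sums_alternating:
  fixes x :: real
  assumes "0 \<le> x" "x < 1"
  shows "(\<lambda>m. (-1) ^ m * (x ^ Suc m / (1 - x ^ Suc m) / real (Suc m))) sums ln (distinct_gf x)"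
proof (rule sums_swap)
  have x: "0 \<le> x ^ Suc k" "x ^ Suc k < 1" for k
    using assms power_Suc_less_one[of x k] by (auto simp: power_less_one_iff simp del: power_Suc)
  show "(\<lambda>m. \<bar>(-1) ^ m * ((x ^ Suc k) ^ Suc m / real (Suc m))\<bar>) sums (- ln (1 - x ^ Suc k))" for k
    using ln_one_minus_sums[OF x, of k] x[of k] assms by (simp add: abs_mult power_abs del: power_Suc)
  show "summable (\<lambda>k. - ln (1 - x ^ Suc k))"
    using assms by (rule summable_ln_one_minus_power)
  show "(\<lambda>m. (-1) ^ m * ((x ^ Suc k) ^ Suc m / real (Suc m))) sums ln (1 + x ^ Suc k)" for k
    using x[of k] by (rule ln_one_plus_sums)
  show "(\<lambda>k. ln (1 + x ^ Suc k)) sums ln (distinct_gf x)"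
    using assms by (rule ln_distinct_gf_sums)
  show "(\<lambda>k. (-1) ^ m * ((x ^ Suc k) ^ Suc m / real (Suc m))) sums
          ((-1) ^ m * (x ^ Suc m / (1 - x ^ Suc m) / real (Suc m)))" for m
    using geometric_sums_Suc[OF x[of m]]
    by (intro sums_mult sums_divide) (simp add: power_mult[symmetric] mult.commute del: power_Suc)
qed

text \<open>This rests on Euler's identity \<open>\<Prod>(1 + x\<^sup>j) = \<Prod>(1 - x\<^sup>2\<^sup>j\<^sup>-\<^sup>1)\<^sup>-\<^sup>1\<close>.\<close>

lemma ln_distinct_gf_sums_odd:
  fixes x :: real
  assumes "0 \<le> x" "x < 1"
  shows "(\<lambda>m. x ^ Suc m / (1 - (x ^ Suc m)\<^sup>2) / real (Suc m)) sums ln (distinct_gf x)"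
proof -
  define L where "L = (\<lambda>j. - ln (1 - x ^ Suc j))"
  have x: "0 \<le> x ^ Suc k" "x ^ Suc k < 1" for k
    using assms power_Suc_less_one[of x k] by (auto simp: power_less_one_iff simp del: power_Suc)
  have L: "L sums suminf L"
    using summable_ln_one_minus_power[OF assms] unfolding L_def by (rule summable_sums)
  \<comment> \<open>\<open>L 0\<close> belongs to exponent 1, so \<open>L (2 * n)\<close> carries
    the odd exponents and \<open>L (Suc (2 * n))\<close> the even ones. Factoring 1 - x^(2n+2) as a
    difference of squares expresses the even ones by \<open>L n\<close> and the terms of the wanted
    logarithm.\<close>
  have "(\<lambda>n. L (2 * n) + L (Suc (2 * n))) sums suminf L"
    using sums_group[OF L, of 2] by (simp add: mult.commute add.commute atLeastLessThanSuc eval_nat_numeral)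
  moreover have "(\<lambda>n. L n - ln (1 + x ^ Suc n)) sums (suminf L - ln (distinct_gf x))"
    by (intro sums_diff L ln_distinct_gf_sums assms)
  moreover have "L n - ln (1 + x ^ Suc n) = L (Suc (2 * n))" for n
  proof -
    have "1 - x ^ Suc (Suc (2 * n)) = (1 - x ^ Suc n) * (1 + x ^ Suc n)"
      by (simp add: algebra_simps flip: power_add mult_2)
    hence "ln (1 - x ^ Suc (Suc (2 * n))) = ln (1 - x ^ Suc n) + ln (1 + x ^ Suc n)"
      using x[of n] by (simp add: ln_mult del: power_Suc)
    thus ?thesis by (simp add: L_def del: power_Suc)
  qed
  ultimately have "(\<lambda>n. (L (2 * n) + L (Suc (2 * n))) - L (Suc (2 * n))) sums
       (suminf L - (suminf L - ln (distinct_gf x)))"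
    by (intro sums_diff) auto
  hence odd: "(\<lambda>n. L (2 * n)) sums ln (distinct_gf x)" by simp
  show ?thesis
  proof (rule sums_swap[where f = "\<lambda>m k. (x ^ Suc (2 * k)) ^ Suc m / real (Suc m)"
                          and B = "\<lambda>k. L (2 * k)", OF _ _ _ _ odd])
    show "(\<lambda>m. (x ^ Suc (2 * k)) ^ Suc m / real (Suc m)) sums L (2 * k)" for k
      unfolding L_def using x by (rule ln_one_minus_sums)
    thus "(\<lambda>m. \<bar>(x ^ Suc (2 * k)) ^ Suc m / real (Suc m)\<bar>) sums L (2 * k)" for k
      using x[of "2 * k"] assms by (simp add: power_abs del: power_Suc)
    show "summable (\<lambda>k. L (2 * k))" using odd by (rule sums_summable)
    show "(\<lambda>k. (x ^ Suc (2 * k)) ^ Suc m / real (Suc m)) sums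
            (x ^ Suc m / (1 - (x ^ Suc m)\<^sup>2) / real (Suc m))" for m
    proof (intro sums_divide)
      have "(x ^ Suc m)\<^sup>2 < 1" using x[of m] by (simp add: power_less_one_iff del: power_Suc)
      hence "(\<lambda>k. x ^ Suc m * ((x ^ Suc m)\<^sup>2) ^ k) sums (x ^ Suc m * (1 / (1 - (x ^ Suc m)\<^sup>2)))"
        by (intro sums_mult geometric_sums) simp
      also have "(\<lambda>k. x ^ Suc m * ((x ^ Suc m)\<^sup>2) ^ k) = (\<lambda>k. (x ^ Suc (2 * k)) ^ Suc m)"
        by (intro ext) (simp only: power_mult[symmetric] power_add[symmetric], simp add: algebra_simps)
      finally show "(\<lambda>k. (x ^ Suc (2 * k)) ^ Suc m) sums (x ^ Suc m / (1 - (x ^ Suc m)\<^sup>2))"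
        by simp
    qed
  qed
qed

subsection \<open>The transformation formula\<close>

text \<open>Subtracting from the series of \<pi>^2/6 twice its terms with even denominator flips
  their signs; these terms add up to a quarter of the series.\<close>

lemma alternating_inverse_squares_sums:
  "(\<lambda>m. (-1) ^ m / (real (Suc m))\<^sup>2) sums (pi\<^sup>2 / 12)"
proof -
  have 1: "(\<lambda>m. 1 / (real (Suc m))\<^sup>2) sums (pi\<^sup>2 / 6)"
    using inverse_squares_sums by (simp add: add.commute)
  have "(\<lambda>m. 1 / 4 * (1 / (real (Suc m))\<^sup>2)) sums (1 / 4 * (pi\<^sup>2 / 6))"
    using 1 by (rule sums_mult)
  hence "(\<lambda>m. 1 / (2 * real (Suc m))\<^sup>2) sums (pi\<^sup>2 / 24)"
    by (simp add: power_mult_distrib del: of_nat_Suc)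
  hence "(\<lambda>m. if even m then 0 else 2 * (1 / (2 * real (Suc ((m - 1) div 2)))\<^sup>2)) sums (2 * (pi\<^sup>2 / 24))"
    by (intro sums_if' sums_mult)
  from sums_diff[OF 1 this]
  have "(\<lambda>m. 1 / (real (Suc m))\<^sup>2 - (if even m then 0 else 2 * (1 / (2 * real (Suc ((m - 1) div 2)))\<^sup>2)))
         sums (pi\<^sup>2 / 6 - 2 * (pi\<^sup>2 / 24))" .
  also have "(\<lambda>m. 1 / (real (Suc m))\<^sup>2 - (if even m then 0 else 2 * (1 / (2 * real (Suc ((m - 1) div 2)))\<^sup>2))) =
             (\<lambda>m. (-1) ^ m / (real (Suc m))\<^sup>2)"
    by (intro ext) (auto elim!: oddE)
  finally show ?thesis by simp
qed

lemma sums_pairs: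
  fixes f :: "nat \<Rightarrow> real"
  assumes "(\<lambda>m. (-1) ^ m * f m) sums S"
  shows "(\<lambda>l. f (2 * l) - f (Suc (2 * l))) sums S"
  using sums_group[OF assms, of 2]
  by (simp add: mult.commute[of _ 2] atLeastLessThanSuc numeral_2_eq_2[symmetric])

text \<open>Both logarithms are reduced by the expansion of the hyperbolic cotangent to the double series
  \<open>\<Sum>\<^sub>m\<^sub>,\<^sub>k (-1)\<^sup>m / (m\<^sup>2 t\<^sup>2 + k\<^sup>2)\<close>, summed in the two possible orders. Grouping the terms with
  \<open>m = 2 l - 1\<close> and \<open>m = 2 l\<close> makes it a double series of non-negative terms.\<close>

lemma ln_distinct_gf_transformation:
  fixes t :: real
  assumes t: "t > 0"
  shows "ln (distinct_gf (exp (-2 * pi * t))) + ln (distinct_gf (exp (- pi / t))) =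
         pi / (24 * t) + pi * t / 12 - ln 2 / 2"
proof -
  \<comment> \<open>\<open>E\<close> is the Lambert term of the logarithms, \<open>C y\<close> the
    series over k that \<open>coth_partial_fractions\<close> attaches to it.\<close>
  define E where "E = (\<lambda>y::real. 1 / (exp (2 * pi * y) - 1))"
  define C where "C = (\<lambda>y::real. pi / y * (E y + 1 / 2 - 1 / (2 * pi * y)))"
  have C: "(\<lambda>k. 1 / (y\<^sup>2 + (real (Suc k))\<^sup>2)) sums C y" if "y > 0" for y
    using coth_partial_fractions[OF that] by (simp add: C_def E_def)
  have E_eq: "E y = - 1 / 2 + 1 / (2 * pi * y) + y / pi * C y" if "y > 0" for y
    using that by (simp add: C_def field_simps)
  define x where "x = exp (-2 * pi * t)"
  define p where "p = exp (- pi / t)"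
  have x: "0 \<le> x" "x < 1" and p: "0 \<le> p" "p < 1" using t by (auto simp: x_def p_def)
  define c where "c = (\<lambda>l k. 1 / ((real (Suc (2 * l)) * t)\<^sup>2 + (real (Suc k))\<^sup>2) -
                             1 / ((real (Suc (Suc (2 * l))) * t)\<^sup>2 + (real (Suc k))\<^sup>2))"
  define A where "A = (\<lambda>l. C (real (Suc (2 * l)) * t) - C (real (Suc (Suc (2 * l))) * t))"
  define B where "B = (\<lambda>k. 1 / t\<^sup>2 * (C (real (Suc k) / t) - C (real (Suc k) / t / 2) / 2))"

  have c_nonneg: "c l k \<ge> 0" for l k
  proof -
    have "(real (Suc (2 * l)) * t)\<^sup>2 \<le> (real (Suc (Suc (2 * l))) * t)\<^sup>2"
      using t by (intro power_mono mult_right_mono) auto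
    thus ?thesis unfolding c_def
      by (simp add: divide_left_mono add_nonneg_pos mult_pos_pos del: of_nat_Suc)
  qed

  have A: "(\<lambda>k. c l k) sums A l" for l
    unfolding c_def A_def using t by (intro sums_diff C) auto

  \<comment> \<open>With w = (k+1)/t a factor 1/t^2 comes out. The alternating sum is the full sum
    \<open>C w\<close> minus twice its even part, and the even part is \<open>C (w / 2) / 4\<close>
    by rescaling.\<close>
  have B: "(\<lambda>l. c l k) sums B k" for k
  proof -
    define w where "w = real (Suc k) / t"
    have w: "w > 0" using t by (simp add: w_def)
    have "(\<lambda>l. 1 / (w\<^sup>2 + (real (Suc (2 * l)))\<^sup>2) + 1 / (w\<^sup>2 + (real (Suc (Suc (2 * l))))\<^sup>2)) sums C w"
      using sums_group[OF C[OF w], of 2]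
      by (simp add: mult.commute add.commute atLeastLessThanSuc eval_nat_numeral)
    moreover have "(\<lambda>l. 1 / 4 * (1 / ((w / 2)\<^sup>2 + (real (Suc l))\<^sup>2))) sums (1 / 4 * C (w / 2))"
      using w by (intro sums_mult C) auto
    moreover have "1 / 4 * (1 / ((w / 2)\<^sup>2 + (real (Suc l))\<^sup>2)) = 1 / (w\<^sup>2 + (real (Suc (Suc (2 * l))))\<^sup>2)" for l
      by (simp add: power2_eq_square field_simps)
    ultimately have "(\<lambda>l. (1 / (w\<^sup>2 + (real (Suc (2 * l)))\<^sup>2) + 1 / (w\<^sup>2 + (real (Suc (Suc (2 * l))))\<^sup>2))
        - 2 * (1 / (w\<^sup>2 + (real (Suc (Suc (2 * l))))\<^sup>2))) sums (C w - 2 * (1 / 4 * C (w / 2)))"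
      by (intro sums_diff sums_mult) auto
    from sums_mult[OF this, of "1 / t\<^sup>2"]
    have "(\<lambda>l. 1 / t\<^sup>2 * (1 / (w\<^sup>2 + (real (Suc (2 * l)))\<^sup>2) - 1 / (w\<^sup>2 + (real (Suc (Suc (2 * l))))\<^sup>2))) sums B k"
      by (simp add: B_def w_def algebra_simps)
    moreover have "1 / t\<^sup>2 * (1 / (w\<^sup>2 + (real (Suc (2 * l)))\<^sup>2) - 1 / (w\<^sup>2 + (real (Suc (Suc (2 * l))))\<^sup>2)) = c l k" for l
    proof -
      have "1 / t\<^sup>2 * (1 / (w\<^sup>2 + u\<^sup>2)) = 1 / ((u * t)\<^sup>2 + (real (Suc k))\<^sup>2)" for u
        using t by (simp add: w_def power_divide power_mult_distrib field_simps del: of_nat_Suc)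
      thus ?thesis by (simp only: c_def right_diff_distrib)
    qed
    ultimately show ?thesis by simp
  qed

  have "B sums (pi / t * (pi * t / 12 - ln (distinct_gf p)))"
  proof -
    have "p ^ Suc m / (1 - (p ^ Suc m)\<^sup>2) / real (Suc m) = t / (2 * pi) * (1 / (real (Suc m))\<^sup>2) - t / pi * B m" for m
    proof -
      define w where "w = real (Suc m) / t"
      have w: "w > 0" using t by (simp add: w_def)
      have "p ^ Suc m = exp (real (Suc m) * (- pi / t))"
        by (simp only: p_def exp_of_nat_mult)
      hence pm: "p ^ Suc m = exp (- pi * w)" by (simp add: w_def mult.commute del: power_Suc)
      define u where "u = exp (pi * w)"
      have u: "u > 1" using w by (simp add: u_def)
      hence uu: "u * u > 1" by (metis less_1_mult)
      have "p ^ Suc m = 1 / u" unfolding pm u_def by (simp add: exp_minus field_simps)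
      \<comment> \<open>For u = exp(\<pi> w) the two fractions on the right are
        \<open>E (w / 2)\<close> and \<open>E w\<close>, which leads to exactly the combination of
        values of \<open>C\<close> in \<open>B\<close>.\<close>
      moreover have "1 / u / (1 - (1 / u)\<^sup>2) = 1 / (u - 1) - 1 / (u * u - 1)"
        using u uu by (simp add: power2_eq_square divide_simps) (simp add: algebra_simps)
      ultimately have "p ^ Suc m / (1 - (p ^ Suc m)\<^sup>2) = 1 / (u - 1) - 1 / (u * u - 1)"
        by simp
      also have "\<dots> = E (w / 2) - E w"
        by (simp add: E_def u_def flip: exp_add)
      also have "\<dots> = 1 / (2 * pi * w) - w / pi * (C w - C (w / 2) / 2)"
        using w by (simp add: E_eq field_simps)
      finally have "p ^ Suc m / (1 - (p ^ Suc m)\<^sup>2) / real (Suc m) =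
          (1 / (2 * pi * w) - w / pi * (C w - C (w / 2) / 2)) / real (Suc m)" by simp
      also have "w / pi * (C w - C (w / 2) / 2) = t * real (Suc m) / pi * B m"
        using t by (simp add: B_def w_def field_simps power2_eq_square)
      also have "(1 / (2 * pi * w) - t * real (Suc m) / pi * B m) / real (Suc m) =
                 t / (2 * pi) * (1 / (real (Suc m))\<^sup>2) - t / pi * B m"
        using t by (simp add: w_def field_simps power2_eq_square del: of_nat_Suc)
      finally show ?thesis .
    qed
    with ln_distinct_gf_sums_odd[OF p]
    have 1: "(\<lambda>m. t / (2 * pi) * (1 / (real (Suc m))\<^sup>2) - t / pi * B m) sums ln (distinct_gf p)" by simp
    have 2: "(\<lambda>m. t / (2 * pi) * (1 / (real (Suc m))\<^sup>2)) sums (t / (2 * pi) * (pi\<^sup>2 / 6))"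
      using inverse_squares_sums by (intro sums_mult) (simp add: add.commute)
    have "(\<lambda>m. pi / t * (t / pi * B m)) sums (pi / t * (t / (2 * pi) * (pi\<^sup>2 / 6) - ln (distinct_gf p)))"
      using sums_diff[OF 2 1] by (intro sums_mult) simp
    thus ?thesis using t by (simp add: power2_eq_square mult.commute)
  qed
  moreover have "(\<lambda>l. \<bar>c l k\<bar>) sums B k" for k
    using B[of k] c_nonneg by simp
  ultimately have A_sums: "A sums (pi / t * (pi * t / 12 - ln (distinct_gf p)))"
    using sums_swap[OF _ _ B A] sums_summable by blast

  \<comment> \<open>The other order. Of the three terms of \<open>C\<close>, the first gives the
    logarithm, the constant 1/2 gives ln 2 / 2 (the origin of the sqrt 2 in the transformation
    formula), and the last gives \<pi> / (24t).\<close>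
  have "A sums (pi / t * (ln (distinct_gf x) + ln 2 / 2 - pi / (24 * t)))"
  proof -
    have "(\<lambda>m. (-1) ^ m * (1 / real (Suc m) * E (real (Suc m) * t))) sums ln (distinct_gf x)"
    proof -
      have "x ^ Suc m / (1 - x ^ Suc m) = E (real (Suc m) * t)" for m
      proof -
        define u where "u = exp (2 * pi * (real (Suc m) * t))"
        have u: "u > 1" using t by (simp add: u_def)
        have "x ^ Suc m = exp (real (Suc m) * (-2 * pi * t))"
          by (simp only: x_def exp_of_nat_mult)
        hence "x ^ Suc m = exp (- (2 * pi * (real (Suc m) * t)))"
          by (simp add: mult_ac del: power_Suc of_nat_Suc)
        hence "x ^ Suc m = 1 / u" by (simp only: u_def exp_minus inverse_eq_divide)
        moreover have "1 / u / (1 - 1 / u) = 1 / (u - 1)" using u by (simp add: field_simps)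
        ultimately show ?thesis by (simp only: E_def u_def mult.assoc)
      qed
      hence "(\<lambda>m. (-1) ^ m * (E (real (Suc m) * t) / real (Suc m))) sums ln (distinct_gf x)"
        using ln_distinct_gf_sums_alternating[OF x] by (simp only:)
      thus ?thesis by simp
    qed
    moreover have "(\<lambda>m. (-1) ^ m / real (Suc m)) sums ln 2"
      by (rule alternating_harmonic_series_sums)
    moreover note alternating_inverse_squares_sums
    ultimately have "(\<lambda>m. pi / t * ((-1) ^ m * (1 / real (Suc m) * E (real (Suc m) * t))
        + 1 / 2 * ((-1) ^ m / real (Suc m)) - 1 / (2 * pi * t) * ((-1) ^ m / (real (Suc m))\<^sup>2)))
        sums (pi / t * (ln (distinct_gf x) + 1 / 2 * ln 2 - 1 / (2 * pi * t) * (pi\<^sup>2 / 12)))"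
      by (intro sums_mult sums_add sums_diff)
    also have "(\<lambda>m. pi / t * ((-1) ^ m * (1 / real (Suc m) * E (real (Suc m) * t))
        + 1 / 2 * ((-1) ^ m / real (Suc m)) - 1 / (2 * pi * t) * ((-1) ^ m / (real (Suc m))\<^sup>2))) =
        (\<lambda>m. (-1) ^ m * C (real (Suc m) * t))"
      using t by (intro ext) (simp add: C_def power2_eq_square divide_simps del: of_nat_Suc, simp add: algebra_simps del: of_nat_Suc)
    finally have "(\<lambda>m. (-1) ^ m * C (real (Suc m) * t)) sums
       (pi / t * (ln (distinct_gf x) + 1 / 2 * ln 2 - 1 / (2 * pi * t) * (pi\<^sup>2 / 12)))" .
    from sums_pairs[OF this] show ?thesis
      by (simp add: A_def power2_eq_square)
  qed
  with A_sums have "pi / t * (pi * t / 12 - ln (distinct_gf p)) =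
                    pi / t * (ln (distinct_gf x) + ln 2 / 2 - pi / (24 * t))"
    by (rule sums_unique2)
  thus ?thesis using t by (simp add: x_def p_def)
qed

lemma distinct_gf_transformation_real:
  fixes t :: real
  assumes t: "t > 0"
  shows "distinct_gf (exp (-2 * pi * t)) * distinct_gf (exp (- pi / t)) =
         exp (pi / (24 * t) + pi * t / 12) / sqrt 2"
proof -
  have ge: "distinct_gf (exp (-2 * pi * t)) \<ge> 1" "distinct_gf (exp (- pi / t)) \<ge> 1"
    using t by (auto intro!: distinct_gf_ge_1)
  hence "distinct_gf (exp (-2 * pi * t)) * distinct_gf (exp (- pi / t)) =
        exp (ln (distinct_gf (exp (-2 * pi * t))) + ln (distinct_gf (exp (- pi / t))))"
    by (simp add: exp_add)
  also have "\<dots> = exp (pi / (24 * t) + pi * t / 12) / exp (ln 2 / 2)"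
    by (simp only: ln_distinct_gf_transformation[OF t] exp_diff)
  also have "exp (ln 2 / 2) = sqrt (2 :: real)"
    by (simp add: ln_sqrt[symmetric])
  finally show ?thesis .
qed

text \<open>Identity theorem: both sides are holomorphic on the right half-plane and agree on the
  positive real axis, which accumulates at 1.\<close>

lemma distinct_gf_transformation:
  fixes z :: complex
  assumes z: "Re z > 0"
  shows "distinct_gf (exp (-2 * pi * z)) * distinct_gf (exp (- pi / z)) =
         exp (pi / (24 * z) + pi * z / 12) / sqrt 2"
proof -
  let ?S = "{z. Re z > 0}"
  let ?f = "\<lambda>z :: complex. distinct_gf (exp (-2 * pi * z)) * distinct_gf (exp (- pi / z)) -
         exp (pi / (24 * z) + pi * z / 12) / sqrt 2"
  have nz: "z \<noteq> 0" if "Re z > 0" for z using that by auto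
  have 1: "(\<lambda>z. distinct_gf (exp (-2 * pi * z))) holomorphic_on ?S"
    by (rule holomorphic_on_compose_gen[unfolded o_def, OF _ holomorphic_distinct_gf])
       (auto intro!: holomorphic_intros)
  have 2: "(\<lambda>z. distinct_gf (exp (- pi / z))) holomorphic_on ?S"
  proof (rule holomorphic_on_compose_gen[unfolded o_def, OF _ holomorphic_distinct_gf])
    show "(\<lambda>z. exp (- pi / z)) ` ?S \<subseteq> ball 0 1"
      using nz by (auto simp: Re_divide cmod_power2[symmetric] intro!: divide_pos_pos)
  qed (use nz in \<open>auto intro!: holomorphic_intros\<close>)
  have "?f z = 0"
  proof (rule analytic_continuation[where f = ?f and w = z and S = ?S and U = "of_real ` {0<..}" and \<xi> = 1])
    show "?f holomorphic_on ?S"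
      using nz by (intro holomorphic_intros 1 2) auto
    show "open ?S" by (rule open_halfspace_Re_gt)
    show "connected ?S" by (intro convex_connected convex_halfspace_Re_gt)
    show "1 islimpt (of_real ` {0<..} :: complex set)"
    proof -
      have "(1 :: real) islimpt {0<..}"
        by (intro interior_limit_point) (auto simp: interior_open)
      from islimpt_isCont_image[OF this, of complex_of_real] show ?thesis
        by (simp add: eventually_at_filter)
    qed
    fix w :: complex assume "w \<in> of_real ` {0<..}"
    then obtain t where t: "t > 0" "w = of_real t" by auto
    have "distinct_gf (exp (-2 * pi * w)) = complex_of_real (distinct_gf (exp (-2 * pi * t)))"
      using t by (subst distinct_gf_of_real[symmetric]) (auto simp: exp_of_real[symmetric])
    moreover have "distinct_gf (exp (- pi / w)) = complex_of_real (distinct_gf (exp (- pi / t)))"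
      using t by (subst distinct_gf_of_real[symmetric]) (auto simp: exp_of_real[symmetric])
    moreover have "exp (pi / (24 * w) + pi * w / 12) / sqrt 2 =
       complex_of_real (exp (pi / (24 * t) + pi * t / 12) / sqrt 2)"
      using t by (simp add: exp_of_real[symmetric])
    ultimately show "?f w = 0"
      using distinct_gf_transformation_real[OF t(1)] by (simp flip: of_real_mult)
  qed (use z in auto)
  thus ?thesis by simp
qed

subsection \<open>Reduction under the Fricke group of level 2\<close>

text \<open>The absolute value of the Weber function \<open>\<ff>\<^sub>2(\<tau>) = \<surd>2 \<eta>(2\<tau>) / \<eta>(\<tau>)\<close>.\<close>

definition weber :: "complex \<Rightarrow> real" where
  "weber \<tau> = sqrt 2 * exp (- pi * Im \<tau> / 12) * norm (distinct_gf (exp (2 * pi * \<i> * \<tau>)))"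

lemma norm_exp_2pii: "norm (exp (2 * pi * \<i> * \<tau>)) = exp (- 2 * pi * Im \<tau>)"
  by simp

lemma weber_plus_of_int: "weber (\<tau> + of_int k) = weber \<tau>"
proof -
  have "exp (2 * pi * \<i> * (\<tau> + of_int k)) = exp (2 * pi * \<i> * \<tau>) * exp (2 * of_int k * pi * \<i>)"
    by (simp add: exp_add[symmetric] algebra_simps)
  also have "exp (2 * of_int k * pi * \<i>) = 1"
    by (rule exp_integer_2pi) auto
  finally show ?thesis by (simp add: weber_def)
qed

lemma Im_minus_inverse_double: "Im (- 1 / (2 * \<tau>)) = Im \<tau> / (2 * (cmod \<tau>)\<^sup>2)"
proof -
  have "Im (- 1 / (2 * \<tau>)) = 2 * Im \<tau> / ((2 * Re \<tau>)\<^sup>2 + (2 * Im \<tau>)\<^sup>2)"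
    by (simp add: Im_divide)
  also have "(2 * Re \<tau>)\<^sup>2 + (2 * Im \<tau>)\<^sup>2 = 2 * (2 * (cmod \<tau>)\<^sup>2)"
    unfolding cmod_power2 by (simp add: power_mult_distrib)
  finally show ?thesis by simp
qed

text \<open>With z = -i \<tau> this is the absolute value of the transformation formula; the
  exponential factor in \<open>weber\<close> is what makes the exponentials cancel.\<close>

lemma weber_fricke:
  assumes "Im \<tau> > 0"
  shows "weber \<tau> * weber (- 1 / (2 * \<tau>)) = sqrt 2"
proof -
  define z where "z = - \<i> * \<tau>"
  have z: "Re z > 0" "z \<noteq> 0" and \<tau>: "\<tau> = \<i> * z" using assms by (auto simp: z_def)
  have "2 * pi * \<i> * \<tau> = - 2 * pi * z" by (simp add: \<tau> complex_eq_iff)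
  hence 1: "exp (2 * pi * \<i> * \<tau>) = exp (- 2 * pi * z)" by (rule arg_cong)
  have 2: "exp (2 * pi * \<i> * (- 1 / (2 * \<tau>))) = exp (- pi / z)"
    using z by (simp add: \<tau> field_simps)
  have 3: "Im (- 1 / (2 * \<tau>)) = Re (1 / z) / 2"
  proof -
    have "Re (1 / z) = Re z / (cmod z)\<^sup>2" by (simp add: Re_divide cmod_power2)
    thus ?thesis unfolding Im_minus_inverse_double by (simp add: \<tau> norm_mult)
  qed
  have "norm (distinct_gf (exp (2 * pi * \<i> * \<tau>))) * norm (distinct_gf (exp (2 * pi * \<i> * (- 1 / (2 * \<tau>))))) =
        norm (exp (pi / (24 * z) + pi * z / 12) / sqrt 2)"
    unfolding 1 2 norm_mult[symmetric] distinct_gf_transformation[OF z(1)] ..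
  also have "\<dots> = exp (Re (pi / (24 * z) + pi * z / 12)) / sqrt 2"
    by (simp add: norm_divide)
  also have "pi / (24 * z) + pi * z / 12 = of_real (pi / 24) * (1 / z) + of_real (pi / 12) * z"
    by simp
  also have "Re (of_real (pi / 24) * (1 / z) + of_real (pi / 12) * z) = pi * Re (1 / z) / 24 + pi * Im \<tau> / 12"
  proof -
    have "Re (of_real r * w) = r * Re w" for r w by simp
    thus ?thesis by (simp only: plus_complex.sel) (simp add: \<tau>)
  qed
  finally have norms: "norm (distinct_gf (exp (2 * pi * \<i> * \<tau>))) *
      norm (distinct_gf (exp (2 * pi * \<i> * (- 1 / (2 * \<tau>))))) =
      exp (pi * Re (1 / z) / 24 + pi * Im \<tau> / 12) / sqrt 2" .
  have "weber \<tau> * weber (- 1 / (2 * \<tau>)) =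
     sqrt 2 * sqrt 2 * (exp (- pi * Im \<tau> / 12) * exp (- pi * (Re (1 / z) / 2) / 12) *
       (norm (distinct_gf (exp (2 * pi * \<i> * \<tau>))) *
        norm (distinct_gf (exp (2 * pi * \<i> * (- 1 / (2 * \<tau>)))))))"
    unfolding weber_def 3 by (simp only: mult_ac)
  also note norms
  also have "exp (- pi * Im \<tau> / 12) * exp (- pi * (Re (1 / z) / 2) / 12) *
       (exp (pi * Re (1 / z) / 24 + pi * Im \<tau> / 12) / sqrt 2) = 1 / sqrt 2"
    by (simp flip: exp_add)
  finally show ?thesis by (simp add: real_div_sqrt)
qed

section \<open>Size of the Weber function at height at least 1/2\<close>

text \<open>exp(-\<pi>) is the norm of exp(2 \<pi> i \<tau>) at height 1/2, the least height that
  the reduction leaves. The number 41/32 = 1 + 1/4 + 1/32 is the quadratic Taylor value for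
  exp(1/4).\<close>

lemma exp_minus_pi_le: "exp (- pi) \<le> 1 / 19"
proof -
  have "(41 / 32) ^ 12 \<le> exp (1 / 4 :: real) ^ 12"
    using exp_lower_Taylor_quadratic[of "1 / 4"] by (intro power_mono) (auto simp: power2_eq_square)
  also have "exp (1 / 4 :: real) ^ 12 = exp 3"
    by (simp flip: exp_of_nat_mult)
  also have "exp 3 \<le> exp pi" using pi_gt3 by simp
  finally have "(41 / 32) ^ 12 \<le> exp pi" .
  moreover have "19 \<le> (41 / 32 :: real) ^ 12" by (simp add: power_divide)
  ultimately have "19 \<le> exp pi" by linarith
  thus ?thesis by (simp add: exp_minus field_simps)
qed

lemma distinct_gf_minus_1_le:
  fixes r :: real
  assumes "0 \<le> r" "r \<le> 1 / 19"
  shows "distinct_gf r - 1 \<le> 1.12 * r"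
proof -
  define s where "s = r / (1 - r)"
  have "s \<le> r / (18 / 19)" unfolding s_def using assms by (intro divide_left_mono) auto
  hence s: "0 \<le> s" "s \<le> 19 / 18 * r" using assms by (auto simp: s_def)
  have "distinct_gf r \<le> exp s" unfolding s_def using assms by (intro distinct_gf_le_exp) auto
  also have "exp s \<le> 1 + s + s\<^sup>2" using s assms by (intro exp_bound) auto
  \<comment> \<open>Here s \<le> 1/18, so 1 + s + s^2 \<le> 1 + (19/18) s \<le> 1 + (19/18)^2 r, and
    (19/18)^2 < 1.12.\<close>
  also have "s\<^sup>2 \<le> 1 / 18 * s"
    unfolding power2_eq_square using s assms by (intro mult_right_mono) auto
  finally show ?thesis using s by simp
qed

lemma norm_distinct_gf_bounds:
  fixes x :: complex
  assumes "norm x \<le> 1 / 19"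
  shows "norm (distinct_gf x) \<le> 1.059" "norm (distinct_gf x) \<ge> 0.941"
proof -
  have "norm (distinct_gf x - 1) \<le> distinct_gf (norm x) - 1"
    using assms by (intro norm_distinct_gf_minus_1_le) auto
  also have "\<dots> \<le> 1.12 * norm x" using assms by (intro distinct_gf_minus_1_le) auto
  also have "\<dots> \<le> 0.059" using assms by simp
  finally have *: "norm (distinct_gf x - 1) \<le> 0.059" .
  show "norm (distinct_gf x) \<le> 1.059"
    using * norm_triangle_ineq[of "distinct_gf x - 1" 1] by simp
  show "norm (distinct_gf x) \<ge> 0.941"
    using * norm_triangle_ineq[of "1 - distinct_gf x" "distinct_gf x"]
    by (simp add: norm_minus_commute)
qed

lemma norm_exp_2pii_le:
  assumes "1 / 2 \<le> Im \<tau>"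
  shows "norm (exp (2 * pi * \<i> * \<tau>)) \<le> 1 / 19"
proof -
  have "exp (- 2 * pi * Im \<tau>) \<le> exp (- pi)" using assms by simp
  thus ?thesis using exp_minus_pi_le unfolding norm_exp_2pii by linarith
qed

lemma weber_le:
  assumes "1 / 2 \<le> Im \<tau>"
  shows "weber \<tau> \<le> 1.5"
proof -
  have "weber \<tau> \<le> sqrt 2 * 1 * 1.059"
    unfolding weber_def using norm_distinct_gf_bounds[OF norm_exp_2pii_le[OF assms]] assms
    by (intro mult_mono) auto
  also have "sqrt 2 \<le> 1.4143" by (rule real_le_lsqrt) (auto simp: power2_eq_square)
  finally show ?thesis by simp
qed

text \<open>Points reached through the Fricke involution have Weber value
  \<open>sqrt 2 / weber \<tau>\<close>, so the lower bound takes this reciprocal form. The constant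
  is 1 / 0.941 < 1.07.\<close>

lemma weber_ge:
  assumes "1 / 2 \<le> Im \<tau>"
  shows "sqrt 2 / weber \<tau> \<le> 1.07 * exp (pi * Im \<tau> / 12)" "weber \<tau> > 0"
proof -
  define N where "N = norm (distinct_gf (exp (2 * pi * \<i> * \<tau>)))"
  have N: "N \<ge> 0.941"
    unfolding N_def using norm_distinct_gf_bounds[OF norm_exp_2pii_le[OF assms]] by simp
  have w: "weber \<tau> = sqrt 2 * exp (- (pi * Im \<tau> / 12)) * N" by (simp add: weber_def N_def)
  show "weber \<tau> > 0" unfolding w using N by simp
  have "sqrt 2 / weber \<tau> = exp (pi * Im \<tau> / 12) / N"
    unfolding w using N by (simp add: exp_minus field_simps)
  also have "\<dots> \<le> exp (pi * Im \<tau> / 12) / 0.941"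
    using N by (intro divide_left_mono) auto
  also have "\<dots> \<le> 1.07 * exp (pi * Im \<tau> / 12)" by simp
  finally show "sqrt 2 / weber \<tau> \<le> 1.07 * exp (pi * Im \<tau> / 12)" .
qed

lemma Im_moebius:
  fixes a b c d :: int
  assumes "a * d - b * c = 1"
  shows "Im ((of_int a * \<tau> + of_int b) / (of_int c * \<tau> + of_int d)) =
         Im \<tau> / (cmod (of_int c * \<tau> + of_int d))\<^sup>2"
proof -
  have "Im (of_int a * \<tau> + of_int b) * Re (of_int c * \<tau> + of_int d) -
        Re (of_int a * \<tau> + of_int b) * Im (of_int c * \<tau> + of_int d) = of_int (a * d - b * c) * Im \<tau>"
    by (simp add: algebra_simps)
  thus ?thesis unfolding Im_divide assms cmod_power2 by simp
qed

lemma cmod_linear_lower: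
  fixes c d :: int
  assumes "Im \<tau> > 0" "(c, d) \<noteq> (0, 0)"
  shows "cmod (of_int c * \<tau> + of_int d) > 0"
proof -
  have "of_int c * \<tau> + of_int d \<noteq> 0"
    using assms by (auto simp: complex_eq_iff)
  thus ?thesis by simp
qed

text \<open>Reduction theory of the group generated by \<open>\<Gamma>\<^sub>0(2)\<close> and the Fricke involution
  \<open>\<tau> \<mapsto> -1/(2\<tau>)\<close>: an orbit point of maximal height has imaginary part at least \<open>1/2\<close>. The tuple
  \<open>(e, a, b, c, d)\<close> stands for the map \<open>\<tau> \<mapsto> (a\<tau> + b)/(c\<tau> + d)\<close> if \<open>e\<close> holds and
  \<open>\<tau> \<mapsto> (a\<tau> + b)/(2(c\<tau> + d))\<close> otherwise; \<open>weber\<close> is invariant under the former and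
  inverted, up to the factor \<open>\<surd>2\<close>, by the latter.\<close>

definition fricke_map :: "complex \<Rightarrow> bool \<times> int \<times> int \<times> int \<times> int \<Rightarrow> complex" where
  "fricke_map \<tau> = (\<lambda>(e, a, b, c, d). (of_int a * \<tau> + of_int b) /
      ((if e then 1 else 2) * (of_int c * \<tau> + of_int d)))"

text \<open>No group is formed: the set collects the integer tuples of determinant 1 for which the
  behaviour of \<open>weber\<close> is established. The parity condition moves from \<open>c\<close>
  to \<open>a\<close> because the involution exchanges the rows.\<close>

definition fricke_orbit :: "complex \<Rightarrow> (bool \<times> int \<times> int \<times> int \<times> int) set" where
  "fricke_orbit \<tau> = {(e, a, b, c, d). a * d - b * c = 1 \<and> even (if e then c else a) \<and>
     (if e then weber (fricke_map \<tau> (e, a, b, c, d)) = weber \<tau>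
      else weber (fricke_map \<tau> (e, a, b, c, d)) * weber \<tau> = sqrt 2)}"

lemma Im_fricke_map:
  assumes "a * d - b * c = 1"
  shows "Im (fricke_map \<tau> (e, a, b, c, d)) =
         Im \<tau> / ((if e then 1 else 2) * (cmod (of_int c * \<tau> + of_int d))\<^sup>2)"
proof (cases e)
  case False
  have "fricke_map \<tau> (e, a, b, c, d) = of_real (1 / 2) * ((of_int a * \<tau> + of_int b) / (of_int c * \<tau> + of_int d))"
    using False by (simp add: fricke_map_def)
  moreover have "Im (of_real r * w) = r * Im w" for r w by simp
  ultimately have "Im (fricke_map \<tau> (e, a, b, c, d)) =
      1 / 2 * Im ((of_int a * \<tau> + of_int b) / (of_int c * \<tau> + of_int d))"
    by (simp only:)
  thus ?thesis using False by (simp add: Im_moebius[OF assms])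
qed (simp add: fricke_map_def Im_moebius[OF assms])

lemma fricke_orbit_translate:
  assumes "(e, a, b, c, d) \<in> fricke_orbit \<tau>" "Im \<tau> > 0"
  obtains a' b' where "(e, a', b', c, d) \<in> fricke_orbit \<tau>"
    "fricke_map \<tau> (e, a', b', c, d) = fricke_map \<tau> (e, a, b, c, d) + of_int k"
proof -
  \<comment> \<open>Without \<open>e\<close> the denominator carries a factor 2, so translating by k
    adds 2k times the lower row; this also keeps \<open>a\<close> even.\<close>
  define m where "m = (if e then k else 2 * k)"
  have ad: "a * d - b * c = 1" using assms by (auto simp: fricke_orbit_def)
  hence "(c, d) \<noteq> (0, 0)" by auto
  from cmod_linear_lower[OF assms(2) this] have nz: "of_int c * \<tau> + of_int d \<noteq> 0" by auto
  have shift: "(A + of_int m * D) / ((if e then 1 else 2) * D) = A / ((if e then 1 else 2) * D) + of_int k"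
    if "D \<noteq> 0" for A D :: complex
    using that by (simp add: m_def add_divide_distrib)
  have "of_int (a + m * c) * \<tau> + of_int (b + m * d) =
        (of_int a * \<tau> + of_int b) + of_int m * (of_int c * \<tau> + of_int d)"
    by (simp add: algebra_simps)
  hence eq: "fricke_map \<tau> (e, a + m * c, b + m * d, c, d) = fricke_map \<tau> (e, a, b, c, d) + of_int k"
    unfolding fricke_map_def prod.case by (simp only: shift[OF nz])
  have "(e, a + m * c, b + m * d, c, d) \<in> fricke_orbit \<tau>"
    using assms(1) unfolding fricke_orbit_def mem_Collect_eq prod.case eq weber_plus_of_int
    by (auto simp: m_def algebra_simps split: if_splits)
  with eq that show thesis by blast
qed

text \<open>The involution exchanges the rows up to sign. Its factor 2 either enters the denominator
  or cancels the one already there, so \<open>e\<close> flips.\<close>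

lemma fricke_orbit_invert:
  assumes "(e, a, b, c, d) \<in> fricke_orbit \<tau>" "Im \<tau> > 0"
  shows "(\<not> e, - c, - d, a, b) \<in> fricke_orbit \<tau>"
    "fricke_map \<tau> (\<not> e, - c, - d, a, b) = - 1 / (2 * fricke_map \<tau> (e, a, b, c, d))"
proof -
  have ad: "a * d - b * c = 1" using assms by (auto simp: fricke_orbit_def)
  hence "(c, d) \<noteq> (0, 0)" "(a, b) \<noteq> (0, 0)" by auto
  from this[THEN cmod_linear_lower[OF assms(2)]]
  have nz: "of_int c * \<tau> + of_int d \<noteq> 0" "of_int a * \<tau> + of_int b \<noteq> 0" by auto
  show eq: "fricke_map \<tau> (\<not> e, - c, - d, a, b) = - 1 / (2 * fricke_map \<tau> (e, a, b, c, d))"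
  proof -
    have "of_int (- c) * \<tau> + of_int (- d) = - (of_int c * \<tau> + of_int d)" by simp
    moreover have "- D / ((if \<not> e then 1 else 2) * A) = - 1 / (2 * (A / ((if e then 1 else 2) * D)))"
      if "A \<noteq> 0" "D \<noteq> 0" for A D :: complex
      using that by (simp add: field_simps)
    ultimately show ?thesis using nz unfolding fricke_map_def prod.case by (simp only:)
  qed
  have "Im (fricke_map \<tau> (e, a, b, c, d)) > 0"
    unfolding Im_fricke_map[OF ad] using assms(2) nz by auto
  from weber_fricke[OF this]
  have *: "weber (fricke_map \<tau> (e, a, b, c, d)) * weber (fricke_map \<tau> (\<not> e, - c, - d, a, b)) = sqrt 2"
    unfolding eq .
  hence "weber (fricke_map \<tau> (e, a, b, c, d)) \<noteq> 0" by auto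
  moreover have "weber \<tau> \<noteq> 0" using weber_fricke[OF assms(2)] by auto
  moreover from calculation * have "weber (fricke_map \<tau> (\<not> e, - c, - d, a, b)) = weber \<tau>"
    if "weber (fricke_map \<tau> (e, a, b, c, d)) * weber \<tau> = sqrt 2"
    using that by (metis mult_left_cancel)
  ultimately show "(\<not> e, - c, - d, a, b) \<in> fricke_orbit \<tau>"
    using assms(1) * unfolding fricke_orbit_def mem_Collect_eq prod.case
    by (auto simp: algebra_simps split: if_splits)
qed

text \<open>The lattice spanned by 1 and \<tau> is discrete: the imaginary part bounds
  \<open>c\<close>, then the triangle inequality bounds \<open>d\<close>.\<close>

lemma finite_linear_forms_le:
  fixes \<tau> :: complex
  assumes "Im \<tau> > 0"
  shows "finite {(c :: int, d :: int). cmod (of_int c * \<tau> + of_int d) \<le> 1}"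
proof -
  define K where "K = \<lceil>1 / Im \<tau>\<rceil>"
  define L where "L = \<lceil>1 + of_int K * cmod \<tau>\<rceil>"
  have "{(c :: int, d :: int). cmod (of_int c * \<tau> + of_int d) \<le> 1} \<subseteq> {-K..K} \<times> {-L..L}"
  proof clarify
    fix c d :: int
    assume cd: "cmod (of_int c * \<tau> + of_int d) \<le> 1"
    have "\<bar>of_int c\<bar> * Im \<tau> = \<bar>Im (of_int c * \<tau> + of_int d)\<bar>"
      using assms by (simp add: abs_mult)
    also have "\<dots> \<le> 1" using abs_Im_le_cmod cd order_trans by blast
    finally have "of_int \<bar>c\<bar> \<le> 1 / Im \<tau>" using assms by (simp add: field_simps)
    hence c: "\<bar>c\<bar> \<le> K" unfolding K_def by linarith
    have "of_int \<bar>d\<bar> = cmod ((of_int c * \<tau> + of_int d) - of_int c * \<tau>)"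
      by simp
    also have "\<dots> \<le> 1 + of_int \<bar>c\<bar> * cmod \<tau>"
      using norm_triangle_ineq4[of "of_int c * \<tau> + of_int d" "of_int c * \<tau>"] cd
      by (simp add: norm_mult)
    also have "\<dots> \<le> 1 + of_int K * cmod \<tau>"
      using c by (intro add_left_mono mult_right_mono) auto
    finally have "\<bar>d\<bar> \<le> L" unfolding L_def by linarith
    with c show "c \<in> {-K..K} \<and> d \<in> {-L..L}" by auto
  qed
  thus ?thesis by (rule finite_subset) auto
qed

lemma fricke_reduction:
  assumes "Im \<tau> > 0"
  obtains e a b c d where "(e, a, b, c, d) \<in> fricke_orbit \<tau>" "Im (fricke_map \<tau> (e, a, b, c, d)) \<ge> 1 / 2"
proof -
  let ?h = "\<lambda>s. Im (fricke_map \<tau> s)"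
  \<comment> \<open>Heights of at least Im \<tau> force |c \<tau> + d| \<le> 1. Translations make
    \<open>S\<close> infinite, but the height depends only on (e, c, d), so finitely many heights
    occur and a maximum exists.\<close>
  define S where "S = {s \<in> fricke_orbit \<tau>. ?h s \<ge> Im \<tau>}"
  have "(True, 1, 0, 0, 1) \<in> S" by (simp add: S_def fricke_orbit_def fricke_map_def)
  hence ne: "?h ` S \<noteq> {}" by auto
  let ?H = "\<lambda>(e, c, d). Im \<tau> / ((if e then 1 else 2) * (cmod (of_int c * \<tau> + of_int d))\<^sup>2)"
  have "?h ` S \<subseteq> ?H ` (UNIV \<times> {(c :: int, d :: int). cmod (of_int c * \<tau> + of_int d) \<le> 1})"
  proof clarify
    fix e a b c d
    assume "(e, a, b, c, d) \<in> S"
    hence ad: "a * d - b * c = 1" and h: "?h (e, a, b, c, d) \<ge> Im \<tau>"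
      by (auto simp: S_def fricke_orbit_def)
    have heq: "?h (e, a, b, c, d) = ?H (e, c, d)" using Im_fricke_map[OF ad] by simp
    define N where "N = (cmod (of_int c * \<tau> + of_int d))\<^sup>2"
    have "(c, d) \<noteq> (0, 0)" using ad by auto
    from cmod_linear_lower[OF assms this] have N: "N > 0" by (simp add: N_def)
    have "Im \<tau> \<le> Im \<tau> / ((if e then 1 else 2) * N)" using h heq by (simp add: N_def)
    hence "(if e then 1 else 2) * N * Im \<tau> \<le> 1 * Im \<tau>" using N by (simp add: field_simps split: if_splits)
    hence "(if e then 1 else 2) * N \<le> 1" using assms by (simp only: mult_le_cancel_right_pos)
    hence "N \<le> 1" using N by (auto split: if_splits)
    hence "cmod (of_int c * \<tau> + of_int d) \<le> 1"
      unfolding N_def by (simp add: power_le_one_iff)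
    thus "?h (e, a, b, c, d) \<in> ?H ` (UNIV \<times> {(c :: int, d :: int). cmod (of_int c * \<tau> + of_int d) \<le> 1})"
      unfolding heq by (intro imageI) auto
  qed
  hence fin: "finite (?h ` S)"
    by (rule finite_subset) (intro finite_imageI finite_cartesian_product finite_linear_forms_le assms finite)
  obtain s where s: "s \<in> S" "?h s = Max (?h ` S)" using Max_in[OF fin ne] by auto
  obtain e a b c d where s_eq: "s = (e, a, b, c, d)" by (cases s)
  have "?h s \<ge> 1 / 2"
  proof (rule ccontr)
    assume "\<not> ?h s \<ge> 1 / 2"
    hence less: "?h s < 1 / 2" by simp
    \<comment> \<open>A translation brings the real part into [-1/2, 1/2]. With the height below 1/2
      as well, 2 |w|^2 < 1, and the involution strictly raises the height, against
      maximality.\<close>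
    define k where "k = - round (Re (fricke_map \<tau> s))"
    have sO: "(e, a, b, c, d) \<in> fricke_orbit \<tau>" using s s_eq by (simp add: S_def)
    obtain a' b' where t: "(e, a', b', c, d) \<in> fricke_orbit \<tau>"
      "fricke_map \<tau> (e, a', b', c, d) = fricke_map \<tau> s + of_int k"
      using fricke_orbit_translate[OF sO assms] unfolding s_eq by blast
    define w where "w = fricke_map \<tau> (e, a', b', c, d)"
    have w: "\<bar>Re w\<bar> \<le> 1 / 2" "Im w = ?h s"
      using of_int_round_abs_le[of "Re (fricke_map \<tau> s)"] by (auto simp: w_def t k_def abs_minus_commute)
    have pos: "Im w > 0" using s(1) w assms by (auto simp: S_def)
    have "(Re w)\<^sup>2 \<le> (1 / 2)\<^sup>2" using w(1) by (simp add: abs_le_square_iff[symmetric])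
    moreover have "(Im w)\<^sup>2 < (1 / 2)\<^sup>2" using pos less w(2) by (intro power_strict_mono) auto
    ultimately have "2 * (cmod w)\<^sup>2 < 1" unfolding cmod_power2 by (simp add: power2_eq_square)
    moreover have "cmod w > 0" using pos by auto
    ultimately have "Im w < Im w / (2 * (cmod w)\<^sup>2)"
      using pos by (simp add: field_simps)
    also have "\<dots> = ?h (\<not> e, - c, - d, a', b')"
      unfolding fricke_orbit_invert(2)[OF t(1) assms] w_def[symmetric] by (rule Im_minus_inverse_double[symmetric])
    finally have *: "?h s < ?h (\<not> e, - c, - d, a', b')" using w by simp
    hence "(\<not> e, - c, - d, a', b') \<in> S"
      using fricke_orbit_invert(1)[OF t(1) assms] s(1) by (auto simp: S_def)
    hence "?h (\<not> e, - c, - d, a', b') \<le> Max (?h ` S)" using fin by (intro Max_ge) auto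
    with * s show False by simp
  qed
  with s that show thesis unfolding s_eq S_def by blast
qed

text \<open>If the reduced point is reached without the involution, the Weber value is unchanged and
  \<open>weber_le\<close> applies. Otherwise it is inverted and \<open>weber_ge\<close> bounds it by
  the new height; 24 is 12 times the 2 in that height.\<close>

lemma weber_bound:
  assumes "Im \<tau> > 0"
  shows "weber \<tau> \<le> 1.5 \<or> (\<exists>c d. odd c \<and> coprime c d \<and> Im \<tau> / (cmod (of_int c * \<tau> + of_int d))\<^sup>2 \<ge> 1 \<and>
     weber \<tau> \<le> 1.07 * exp (pi / 24 * (Im \<tau> / (cmod (of_int c * \<tau> + of_int d))\<^sup>2)))"
proof -
  obtain e a b c d where s: "(e, a, b, c, d) \<in> fricke_orbit \<tau>" "Im (fricke_map \<tau> (e, a, b, c, d)) \<ge> 1 / 2"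
    using fricke_reduction[OF assms] .
  define w where "w = fricke_map \<tau> (e, a, b, c, d)"
  have ad: "a * d - b * c = 1" using s by (auto simp: fricke_orbit_def)
  show ?thesis
  proof (cases e)
    case True
    hence "weber \<tau> = weber w" using s by (simp add: fricke_orbit_def w_def)
    thus ?thesis using weber_le[of w] s by (simp add: w_def)
  next
    case False
    hence *: "weber w * weber \<tau> = sqrt 2" "even a" using s by (auto simp: fricke_orbit_def w_def)
    \<comment> \<open>With \<open>a\<close> even, determinant 1 makes \<open>b * c\<close> odd: only
      cusps of odd denominator are dangerous.\<close>
    have "odd (b * c)" using ad \<open>even a\<close> by (metis dvd_diff dvd_mult2 even_diff odd_one)
    hence "odd c" by simp
    moreover have "coprime c d"
    proof (rule coprimeI)
      fix k assume "k dvd c" "k dvd d"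
      hence "k dvd a * d - b * c" by simp
      thus "is_unit k" using ad by simp
    qed
    moreover have Imw: "Im w = Im \<tau> / (2 * (cmod (of_int c * \<tau> + of_int d))\<^sup>2)"
      using Im_fricke_map[OF ad, of \<tau> e] False by (simp add: w_def)
    have "weber \<tau> = sqrt 2 / weber w" using * weber_ge(2)[of w] s by (simp add: w_def field_simps)
    hence "weber \<tau> \<le> 1.07 * exp (pi * Im w / 12)" using weber_ge(1)[of w] s by (simp add: w_def)
    moreover have "pi * Im w / 12 = pi / 24 * (Im \<tau> / (cmod (of_int c * \<tau> + of_int d))\<^sup>2)"
      unfolding Imw by simp
    moreover have "Im \<tau> / (cmod (of_int c * \<tau> + of_int d))\<^sup>2 \<ge> 1"
      using s(2) unfolding w_def[symmetric] Imw by simp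
    ultimately show ?thesis by auto
  qed
qed

subsection \<open>The Bessel function as a contour integral\<close>

text \<open>Substitute u = cos t separately on the two half periods, because sin t changes sign;
  both give the same integral.\<close>

lemma has_integral_exp_cos_sin_squared:
  fixes s :: real
  shows "((\<lambda>t. exp (s * cos t) * (sin t)\<^sup>2) has_integral
           2 * integral {-1..1} (\<lambda>u. sqrt (1 - u\<^sup>2) * exp (s * u))) {0..2 * pi}"
proof -
  define f where "f = (\<lambda>u. sqrt (1 - u\<^sup>2) * exp (s * u))"
  have cont: "continuous_on {-1..1} f" unfolding f_def by (intro continuous_intros)
  have deriv: "(cos has_field_derivative - sin x) (at x within A)" for x :: real and A
    by (auto intro!: derivative_eq_intros)
  have f_cos: "f (cos t) = \<bar>sin t\<bar> * exp (s * cos t)" for t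
    by (simp add: f_def sin_squared_eq[symmetric])
  have "((\<lambda>t. - sin t *\<^sub>R f (cos t)) has_integral (integral {cos 0..cos pi} f - integral {cos pi..cos 0} f)) {0..pi}"
    using cont by (intro has_integral_substitution_general[of "{}" _ _ _ "-1" 1] deriv)
                  (auto intro: continuous_intros)
  from has_integral_neg[OF this]
  have "((\<lambda>t. sin t * f (cos t)) has_integral integral {-1..1} f) {0..pi}" by simp
  hence 1: "((\<lambda>t. exp (s * cos t) * (sin t)\<^sup>2) has_integral integral {-1..1} f) {0..pi}"
    by (rule has_integral_eq[rotated]) (auto simp: f_cos sin_ge_zero power2_eq_square)
  have "((\<lambda>t. - sin t *\<^sub>R f (cos t)) has_integral (integral {cos pi..cos (2 * pi)} f - integral {cos (2 * pi)..cos pi} f)) {pi..2 * pi}"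
    using cont by (intro has_integral_substitution_general[of "{}" _ _ _ "-1" 1] deriv)
                  (auto intro: continuous_intros)
  hence "((\<lambda>t. - sin t * f (cos t)) has_integral integral {-1..1} f) {pi..2 * pi}" by simp
  hence 2: "((\<lambda>t. exp (s * cos t) * (sin t)\<^sup>2) has_integral integral {-1..1} f) {pi..2 * pi}"
  proof (rule has_integral_eq[rotated])
    fix t assume "t \<in> {pi..2 * pi}"
    hence "sin t \<le> 0" using sin_ge_zero[of "t - pi"] by simp
    thus "- sin t * f (cos t) = exp (s * cos t) * (sin t)\<^sup>2" by (simp add: f_cos power2_eq_square)
  qed
  from has_integral_combine[OF _ _ 1 2] show ?thesis by (simp add: f_def)
qed

text \<open>Integration by parts: the derivative of sin t exp(s cos t) has zero integral over a
  period. This passes from the defining integral to the one that arises on a circle.\<close>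

lemma has_integral_exp_cos_cos:
  fixes s :: real
  shows "((\<lambda>t. exp (s * cos t) * cos t) has_integral 2 * pi * bessel_I1 s) {0..2 * pi}"
proof -
  have "((\<lambda>t. cos t * exp (s * cos t) - s * (exp (s * cos t) * (sin t)\<^sup>2)) has_integral
         (sin (2 * pi) * exp (s * cos (2 * pi)) - sin 0 * exp (s * cos 0))) {0..2 * pi}"
    by (intro fundamental_theorem_of_calculus)
       (auto intro!: derivative_eq_intros simp: power2_eq_square algebra_simps
             simp flip: has_real_derivative_iff_has_vector_derivative)
  from has_integral_add[OF this has_integral_mult_right[OF has_integral_exp_cos_sin_squared[of s], of s]]
  show ?thesis by (simp add: bessel_I1_def mult_ac)
qed

lemma has_integral_exp_cos_sin:
  fixes s :: real
  assumes "s \<noteq> 0"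
  shows "((\<lambda>t. exp (s * cos t) * sin t) has_integral 0) {0..2 * pi}"
proof -
  have "((\<lambda>t. exp (s * cos t) * sin t) has_integral
         (- exp (s * cos (2 * pi)) / s - (- exp (s * cos 0) / s))) {0..2 * pi}"
    using assms by (intro fundamental_theorem_of_calculus)
       (auto intro!: derivative_eq_intros simp flip: has_real_derivative_iff_has_vector_derivative)
  thus ?thesis by simp
qed

text \<open>The radius sqrt(a/b) balances the two terms of the exponent, which on the circle becomes
  the real number s cos t with s = 2 sqrt(ab).\<close>

lemma contour_integral_circlepath_bessel:
  fixes a b :: real
  assumes "a > 0" "b > 0"
  shows "contour_integral (circlepath 0 (sqrt (a / b))) (\<lambda>z. exp (a / z + b * z)) =
         2 * pi * \<i> * sqrt (a / b) * bessel_I1 (2 * sqrt (a * b))"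
proof -
  define r where "r = sqrt (a / b)"
  define s where "s = 2 * sqrt (a * b)"
  have r: "r > 0" and s: "s > 0" using assms by (auto simp: r_def s_def)
  have ar: "a / r = s / 2" "b * r = s / 2"
    using assms by (auto simp: r_def s_def real_sqrt_divide real_sqrt_mult field_simps)
  have h: "exp (a / (0 + r * cis t) + b * (0 + r * cis t)) = complex_of_real (exp (s * cos t))" for t
  proof -
    have "a / (r * cis t) = of_real (a / r) * cis (- t)" by (simp add: cis_divide[symmetric] divide_inverse cis_inverse)
    moreover have "b * (r * cis t) = of_real (b * r) * cis t" by simp
    ultimately have "a / (0 + r * cis t) + b * (0 + r * cis t) = of_real (s / 2) * (cis (- t) + cis t)"
      unfolding ar by (simp only: add_0_left distrib_left)
    also have "cis (- t) + cis t = of_real (2 * cos t)" by (simp add: complex_eq_iff)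
    finally have "a / (0 + r * cis t) + b * (0 + r * cis t) = of_real (s * cos t)" by simp
    thus ?thesis by (simp only: exp_of_real)
  qed
  have c: "((\<lambda>t. complex_of_real (exp (s * cos t) * cos t)) has_integral of_real (2 * pi * bessel_I1 s)) {0..2 * pi}"
    by (intro has_integral_of_real has_integral_exp_cos_cos)
  have "((\<lambda>t. complex_of_real (exp (s * cos t) * sin t)) has_integral of_real 0) {0..2 * pi}"
    using s by (intro has_integral_of_real has_integral_exp_cos_sin) auto
  from has_integral_mult_right[OF has_integral_add[OF c has_integral_mult_right[OF this, of \<i>]], of "r * \<i>"]
  have "((\<lambda>t. exp (a / (0 + r * cis t) + b * (0 + r * cis t)) * r * \<i> * cis t) has_integral
          (2 * pi * \<i> * r * bessel_I1 s)) {0..2 * pi}"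
    unfolding h by (simp add: cis_conv_exp exp_Euler cos_of_real sin_of_real algebra_simps)
  hence "((\<lambda>z. exp (a / z + b * z)) has_contour_integral (2 * pi * \<i> * r * bessel_I1 s)) (circlepath 0 r)"
    unfolding circlepath_def by (subst has_contour_integral_part_circlepath_iff) auto
  thus ?thesis unfolding r_def s_def by (rule contour_integral_unique)
qed

text \<open>Both contours wind once around 0, the only possible singularity, so each integral is 2
  \<pi> i times the same residue.\<close>

lemma contour_integral_rectpath_eq_circlepath:
  assumes "f holomorphic_on - {0}" "0 < r" "0 \<in> box a1 a2"
  shows "contour_integral (rectpath a1 a2) f = contour_integral (circlepath 0 r) f"
proof -
  have le: "Re a1 \<le> Re a2" "Im a1 \<le> Im a2" using assms(3) by (auto simp: in_box_complex_iff)
  have hol: "f holomorphic_on UNIV - {0}" using assms(1) by (simp add: Compl_eq_Diff_UNIV)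
  have "contour_integral (rectpath a1 a2) f = 2 * pi * \<i> * (\<Sum>p\<in>{0}. winding_number (rectpath a1 a2) p * residue f p)"
    using hol assms(3) path_image_rectpath_inter_box[OF le] by (intro Residue_theorem[of UNIV]) auto
  also have "winding_number (rectpath a1 a2) 0 = winding_number (circlepath 0 r) 0"
    using winding_number_rectpath[OF assms(3)] winding_number_circlepath_centre[OF assms(2), of 0] by simp
  hence "2 * pi * \<i> * (\<Sum>p\<in>{0}. winding_number (rectpath a1 a2) p * residue f p) =
         2 * pi * \<i> * (\<Sum>p\<in>{0}. winding_number (circlepath 0 r) p * residue f p)" by simp
  also have "\<dots> = contour_integral (circlepath 0 r) f"
    using hol assms(2) by (intro Residue_theorem[of UNIV, symmetric]) auto
  finally show ?thesis .
qed

text \<open>The segment is the right side of the rectangle with vertices \<plusminus>\<delta>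
  \<plusminus> i/2. On the left side z and 1/z have negative real parts, so the integrand is at most
  1; on the horizontal sides |z| \<ge> 1/2, so Re(1/z) \<le> 4 \<delta>.\<close>

lemma integral_vertical_segment_bessel:
  fixes a b \<delta> :: real
  assumes pos: "a > 0" "b > 0" "\<delta> > 0"
  shows "norm (integral {-1/2..1/2} (\<lambda>y. exp (a / Complex \<delta> y + b * Complex \<delta> y)) -
               2 * pi * sqrt (a / b) * bessel_I1 (2 * sqrt (a * b)))
         \<le> 1 + 4 * \<delta> * exp (b * \<delta> + 4 * a * \<delta>)"
proof -
  define h where "h = (\<lambda>z :: complex. exp (a / z + b * z))"
  define p1 p2 p3 p4 where "p1 = Complex (-\<delta>) (-1/2)" and "p2 = Complex \<delta> (-1/2)"
    and "p3 = Complex \<delta> (1/2)" and "p4 = Complex (-\<delta>) (1/2)"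
  have hol: "h holomorphic_on - {0}" unfolding h_def by (intro holomorphic_intros) auto
  have box: "0 \<in> box p1 p3" using pos by (simp add: p1_def p3_def in_box_complex_iff)
  have norm_h: "norm (h z) = exp (a * (Re z / (cmod z)\<^sup>2) + b * Re z)" for z
  proof -
    have "a / z = of_real a * (1 / z)" by simp
    moreover have "Re (of_real r * w) = r * Re w" for r w by simp
    moreover have "Re (1 / z) = Re z / (cmod z)\<^sup>2" by (simp add: Re_divide cmod_power2)
    ultimately show ?thesis by (simp only: h_def norm_exp_eq_Re plus_complex.sel)
  qed
  have seg: "closed_segment p1 p2 = {z. Im z = -1/2 \<and> Re z \<in> {-\<delta>..\<delta>}}"
            "closed_segment p2 p3 = {z. Re z = \<delta> \<and> Im z \<in> {-1/2..1/2}}"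
            "closed_segment p3 p4 = {z. Im z = 1/2 \<and> Re z \<in> {-\<delta>..\<delta>}}"
            "closed_segment p4 p1 = {z. Re z = -\<delta> \<and> Im z \<in> {-1/2..1/2}}"
    using pos by (auto simp: p1_def p2_def p3_def p4_def closed_segment_same_Im closed_segment_same_Re closed_segment_eq_real_ivl)
  have int: "h contour_integrable_on linepath p1 p2" "h contour_integrable_on linepath p2 p3"
            "h contour_integrable_on linepath p3 p4" "h contour_integrable_on linepath p4 p1"
    by (intro contour_integrable_continuous_linepath holomorphic_on_imp_continuous_on
              holomorphic_on_subset[OF hol]; use seg pos in auto)+
  have horiz: "norm (h z) \<le> exp (b * \<delta> + 4 * a * \<delta>)" if "\<bar>Im z\<bar> = 1 / 2" "\<bar>Re z\<bar> \<le> \<delta>" for z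
  proof -
    have "(Im z)\<^sup>2 = \<bar>Im z\<bar>\<^sup>2" by simp
    also have "\<dots> = 1 / 4" unfolding that(1) by (simp add: power2_eq_square)
    finally have z: "(cmod z)\<^sup>2 \<ge> 1 / 4" unfolding cmod_power2 by simp
    have "Re z / (cmod z)\<^sup>2 \<le> \<delta> / (cmod z)\<^sup>2"
      using that z by (intro divide_right_mono) auto
    also have "\<dots> \<le> \<delta> / (1 / 4)" using z pos by (intro divide_left_mono) auto
    finally have "a * (Re z / (cmod z)\<^sup>2) \<le> a * (4 * \<delta>)" using pos by (intro mult_left_mono) auto
    moreover have "b * Re z \<le> b * \<delta>" using that pos by (intro mult_left_mono) auto
    ultimately show ?thesis unfolding norm_h by simp
  qed
  have left: "norm (h z) \<le> 1" if "Re z = - \<delta>" for z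
  proof -
    have "a * (Re z / (cmod z)\<^sup>2) \<le> 0" "b * Re z \<le> 0"
      using pos that by (auto intro!: mult_nonneg_nonpos divide_nonpos_nonneg)
    thus ?thesis unfolding norm_h by simp
  qed
  have b1: "norm (contour_integral (linepath p1 p2) h) \<le> exp (b * \<delta> + 4 * a * \<delta>) * (2 * \<delta>)"
  proof -
    have "norm (contour_integral (linepath p1 p2) h) \<le> exp (b * \<delta> + 4 * a * \<delta>) * norm (p2 - p1)"
      using int seg by (intro contour_integral_bound_linepath horiz) auto
    also have "norm (p2 - p1) = 2 * \<delta>" using pos by (simp add: p1_def p2_def cmod_def real_sqrt_mult)
    finally show ?thesis .
  qed
  have b3: "norm (contour_integral (linepath p3 p4) h) \<le> exp (b * \<delta> + 4 * a * \<delta>) * (2 * \<delta>)"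
  proof -
    have "norm (contour_integral (linepath p3 p4) h) \<le> exp (b * \<delta> + 4 * a * \<delta>) * norm (p4 - p3)"
      using int seg by (intro contour_integral_bound_linepath horiz) auto
    also have "norm (p4 - p3) = 2 * \<delta>" using pos by (simp add: p4_def p3_def cmod_def real_sqrt_mult)
    finally show ?thesis .
  qed
  have b4: "norm (contour_integral (linepath p4 p1) h) \<le> 1"
  proof -
    have "norm (contour_integral (linepath p4 p1) h) \<le> 1 * norm (p1 - p4)"
      using int seg by (intro contour_integral_bound_linepath left) auto
    also have "norm (p1 - p4) = 1" using pos by (simp add: p4_def p1_def cmod_def)
    finally show ?thesis by simp
  qed
  define I where "I = integral {-1/2..1/2} (\<lambda>y. h (Complex \<delta> y))"
  define C where "C = 2 * pi * sqrt (a / b) * bessel_I1 (2 * sqrt (a * b))"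
  have "contour_integral (rectpath p1 p3) h = contour_integral (linepath p1 p2) h + (contour_integral (linepath p2 p3) h +
          (contour_integral (linepath p3 p4) h + contour_integral (linepath p4 p1) h))"
  proof -
    have "Complex (Re p3) (Im p1) = p2" "Complex (Re p1) (Im p3) = p4"
      by (simp_all add: p1_def p2_def p3_def p4_def)
    thus ?thesis using int by (simp add: rectpath_def)
  qed
  also have "contour_integral (linepath p2 p3) h = \<i> * I"
    unfolding I_def by (rule contour_integral_linepath_same_Re) (auto simp: p2_def p3_def)
  also have "contour_integral (rectpath p1 p3) h = \<i> * of_real C"
    using contour_integral_rectpath_eq_circlepath[OF hol _ box, of "sqrt (a / b)"] pos
          contour_integral_circlepath_bessel[OF pos(1,2)]
    by (simp add: h_def C_def)
  finally have "\<i> * (I - of_real C) = - (contour_integral (linepath p1 p2) h +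
          contour_integral (linepath p3 p4) h + contour_integral (linepath p4 p1) h)"
    by (simp add: algebra_simps)
  hence "norm (\<i> * (I - of_real C)) = norm (contour_integral (linepath p1 p2) h +
          contour_integral (linepath p3 p4) h + contour_integral (linepath p4 p1) h)"
    by (simp only: norm_minus_cancel)
  also have "\<dots> \<le> exp (b * \<delta> + 4 * a * \<delta>) * (2 * \<delta>) + exp (b * \<delta> + 4 * a * \<delta>) * (2 * \<delta>) + 1"
    by (intro norm_triangle_le add_mono b1 b3 b4)
  also have "\<dots> = 1 + 4 * \<delta> * exp (b * \<delta> + 4 * a * \<delta>)" by simp
  finally show ?thesis by (simp add: norm_mult I_def C_def h_def)
qed

section \<open>Lower bound for the Bessel function\<close>

text \<open>The true order is exp(s) / sqrt(2 \<pi> s), but a weak constant suffices. It comes from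
  an interval of length 0.7/s close to t = 1, with \<pi> \<le> 10/3 and exp(1) \<le> 3.\<close>

lemma bessel_I1_lower_bound:
  fixes s :: real
  assumes "s \<ge> 1"
  shows "bessel_I1 s \<ge> 0.07 * exp s / sqrt s"
proof -
  define f where "f = (\<lambda>t. sqrt (1 - t\<^sup>2) * exp (s * t))"
  have cont: "continuous_on A f" for A unfolding f_def by (intro continuous_intros)
  have le: "exp (s - 1) / sqrt s \<le> f t" if t: "t \<in> {1 - 1 / s..1 - 0.3 / s}" for t
  proof -
    \<comment> \<open>Rescaled variable: t = 1 - (1-u)/s with u in [0, 0.7]. The claim reduces to
      (1-u) exp(2u) \<ge> 1; the quadratic Taylor bound leaves 1 + u(1 - 2u^2) on the left, hence
      the cut-off 0.7 just below 1 / sqrt 2.\<close>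
    define u where "u = 1 - s * (1 - t)"
    have u: "0 \<le> u" "u \<le> 0.7" using t assms by (auto simp: u_def field_simps)
    have t_eq: "t = 1 - (1 - u) / s" using assms by (simp add: u_def)
    have "(1 - u) / s \<le> 1" "0 \<le> (1 - u) / s" using u assms by (auto simp: field_simps)
    hence "(1 - u) / s * ((1 - u) / s) \<le> 1 * ((1 - u) / s)" by (intro mult_right_mono) auto
    moreover have "1 - t\<^sup>2 = 2 * ((1 - u) / s) - (1 - u) / s * ((1 - u) / s)"
      by (simp only: t_eq) (simp add: power2_eq_square algebra_simps)
    ultimately have "(1 - u) / s \<le> 1 - t\<^sup>2" by linarith
    hence 1: "sqrt (1 - u) / sqrt s \<le> sqrt (1 - t\<^sup>2)" by (simp flip: real_sqrt_divide)
    have "s * t = s - 1 + u" using assms by (simp add: u_def algebra_simps)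
    hence 2: "exp (s * t) = exp (s - 1) * exp u" by (simp only: exp_add)
    have "u\<^sup>2 \<le> 0.7\<^sup>2" using u by (intro power_mono) auto
    hence "0 \<le> u * (1 - 2 * u\<^sup>2)" using u by (intro mult_nonneg_nonneg) (auto simp: power2_eq_square)
    hence "1 \<le> (1 - u) * (1 + 2 * u + (2 * u)\<^sup>2 / 2)"
      by (simp add: power2_eq_square algebra_simps)
    also have "\<dots> \<le> (1 - u) * exp (2 * u)"
      using u by (intro mult_left_mono exp_lower_Taylor_quadratic) auto
    finally have "sqrt 1 \<le> sqrt ((1 - u) * (exp u)\<^sup>2)"
      by (simp only: real_sqrt_le_iff exp_double)
    hence 3: "1 \<le> sqrt (1 - u) * exp u" by (simp add: real_sqrt_mult)
    have "exp (s - 1) / sqrt s * 1 \<le> exp (s - 1) / sqrt s * (sqrt (1 - u) * exp u)"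
      using 3 assms by (intro mult_left_mono) auto
    also have "\<dots> = (sqrt (1 - u) / sqrt s) * exp (s * t)" unfolding 2 by simp
    also have "\<dots> \<le> sqrt (1 - t\<^sup>2) * exp (s * t)"
      using 1 by (intro mult_right_mono) auto
    finally show ?thesis by (simp add: f_def)
  qed
  have sub: "{1 - 1 / s..1 - 0.3 / s} \<subseteq> {-1..1}" "1 - 1 / s \<le> 1 - 0.3 / s"
    using assms by (auto simp: field_simps)
  have int: "f integrable_on {c..d}" for c d
    using cont by (rule integrable_continuous_real)
  have "exp (s - 1) / sqrt s * (0.7 / s) = integral {1 - 1 / s..1 - 0.3 / s} (\<lambda>_. exp (s - 1) / sqrt s)"
    using sub(2) by (simp add: field_simps)
  also have "\<dots> \<le> integral {1 - 1 / s..1 - 0.3 / s} f"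
    using int le by (intro integral_le) auto
  also have "\<dots> \<le> integral {-1..1} f"
    using int sub by (intro integral_subset_le) (auto simp: f_def abs_square_le_1)
  finally have "s / pi * (exp (s - 1) / sqrt s * (0.7 / s)) \<le> bessel_I1 s"
    unfolding bessel_I1_def f_def[symmetric] using assms by (intro mult_left_mono) auto
  also have "s / pi * (exp (s - 1) / sqrt s * (0.7 / s)) = 0.7 / (pi * exp 1) * (exp s / sqrt s)"
    using assms by (simp add: exp_diff)
  finally have *: "0.7 / (pi * exp 1) * (exp s / sqrt s) \<le> bessel_I1 s" .
  have "pi * exp 1 \<le> 10 / 3 * 3"
    using pi_approx exp_le by (intro mult_mono) auto
  hence "0.07 \<le> 0.7 / (pi * exp 1)" by (simp add: field_simps)
  hence "0.07 * (exp s / sqrt s) \<le> 0.7 / (pi * exp 1) * (exp s / sqrt s)"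
    using assms by (intro mult_right_mono) auto
  with * show ?thesis by simp
qed

subsection \<open>The circle method\<close>

lemma has_integral_exp_period:
  fixes k :: int
  shows "((\<lambda>x. exp (2 * pi * of_int k * Complex \<delta> x)) has_integral (if k = 0 then 1 else 0)) {-1/2..1/2}"
proof (cases "k = 0")
  case True
  thus ?thesis using has_integral_const_real[of "1 :: complex" "-1/2" "1/2"] by simp
next
  case False
  define F where "F = (\<lambda>w. exp (2 * pi * of_int k * (of_real \<delta> + \<i> * w)) / (2 * pi * of_int k * \<i>))"
  have "((\<lambda>x. exp (2 * pi * of_int k * Complex \<delta> x)) has_integral (F (of_real (1/2)) - F (of_real (-1/2)))) {-1/2..1/2}"
  proof (rule fundamental_theorem_of_calculus)
    fix x :: real
    have "(F has_field_derivative exp (2 * pi * of_int k * (of_real \<delta> + \<i> * of_real x))) (at (of_real x))"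
      unfolding F_def using False by (auto intro!: derivative_eq_intros)
    thus "((\<lambda>x. F (of_real x)) has_vector_derivative exp (2 * pi * of_int k * Complex \<delta> x)) (at x within {-1/2..1/2})"
      unfolding Complex_eq by (rule has_vector_derivative_real_field)
  qed simp
  also have "F (of_real (1/2)) = F (of_real (-1/2))"
  proof -
    have "2 * pi * of_int k * (of_real \<delta> + \<i> * of_real (1/2)) =
          2 * pi * of_int k * (of_real \<delta> + \<i> * of_real (-1/2)) + 2 * of_int k * pi * \<i>"
      by (simp add: algebra_simps)
    moreover have "exp (2 * of_int k * pi * \<i>) = 1"
      by (rule exp_integer_2pi) auto
    ultimately show ?thesis unfolding F_def by (simp only: exp_add mult_1_right)
  qed
  finally show ?thesis using False by simp
qed

text \<open>Cauchy's coefficient formula. The norms of the terms do not depend on x, so the series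
  converges uniformly and is integrated term by term; only m = n survives.\<close>

lemma has_integral_q:
  assumes "\<delta> > 0"
  shows "((\<lambda>x. distinct_gf (exp (-2 * pi * Complex \<delta> x)) * exp (2 * pi * n * Complex \<delta> x)) has_integral
           of_nat (q n)) {-1/2..1/2}"
proof -
  define f where "f = (\<lambda>m x. of_nat (q m) * exp (2 * pi * of_int (int n - int m) * Complex \<delta> x))"
  have f_eq: "f m x = of_nat (q m) * exp (-2 * pi * Complex \<delta> x) ^ m * exp (2 * pi * n * Complex \<delta> x)" for m x
    by (simp add: f_def exp_of_nat_mult[symmetric] exp_add[symmetric] algebra_simps)
  have r: "norm (exp (-2 * pi * \<delta>)) < 1" "exp (-2 * pi * \<delta>) < 1" using assms by auto
  have nf: "norm (f m x) = real (q m) * exp (-2 * pi * \<delta>) ^ m * exp (2 * pi * n * \<delta>)" for m x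
    unfolding f_eq by (simp add: norm_mult norm_power)
  have summ: "summable (\<lambda>m. real (q m) * exp (-2 * pi * \<delta>) ^ m * exp (2 * pi * n * \<delta>))"
    using r by (intro summable_mult2 summable_q_real) auto
  have "uniform_limit {-1/2..1/2} (\<lambda>N x. \<Sum>m<N. f m x) (\<lambda>x. \<Sum>m. f m x) sequentially"
    by (rule Weierstrass_m_test[OF _ summ]) (simp add: nf)
  also have "(\<lambda>x. \<Sum>m. f m x) =
     (\<lambda>x. distinct_gf (exp (-2 * pi * Complex \<delta> x)) * exp (2 * pi * n * Complex \<delta> x))"
  proof
    fix x
    have "summable (\<lambda>m. of_nat (q m) * exp (-2 * pi * Complex \<delta> x) ^ m)"
      using r by (intro summable_norm_cancel[OF summable_norm_q]) auto
    from suminf_mult2[OF this, of "exp (2 * pi * n * Complex \<delta> x)"]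
    show "(\<Sum>m. f m x) = distinct_gf (exp (-2 * pi * Complex \<delta> x)) * exp (2 * pi * n * Complex \<delta> x)"
      by (simp add: f_eq distinct_gf_def)
  qed
  finally have ul: "uniform_limit {-1/2..1/2} (\<lambda>N x. \<Sum>m<N. f m x)
     (\<lambda>x. distinct_gf (exp (-2 * pi * Complex \<delta> x)) * exp (2 * pi * n * Complex \<delta> x)) sequentially" .
  have fm: "(f m has_integral (if m = n then of_nat (q n) else 0)) {-1/2..1/2}" for m
    using has_integral_mult_right[OF has_integral_exp_period[of "int n - int m" \<delta>], of "of_nat (q m)"]
    unfolding f_def by (auto split: if_splits)
  have cont: "continuous_on {-1/2..1/2} (\<lambda>x. \<Sum>m<N. f m x)" for N
    unfolding f_def Complex_eq by (intro continuous_intros)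
  obtain I J where IJ: "\<And>N. ((\<lambda>x. \<Sum>m<N. f m x) has_integral I N) {-1/2..1/2}"
    "((\<lambda>x. distinct_gf (exp (-2 * pi * Complex \<delta> x)) * exp (2 * pi * n * Complex \<delta> x)) has_integral J) {-1/2..1/2}"
    "I \<longlonglongrightarrow> J"
    using uniform_limit_integral[OF ul cont] by auto
  have I: "I N = (if n < N then of_nat (q n) else 0)" for N
  proof -
    have "((\<lambda>x. \<Sum>m<N. f m x) has_integral (\<Sum>m<N. if m = n then of_nat (q n) else 0)) {-1/2..1/2}"
      by (intro has_integral_sum fm) auto
    with IJ(1) have "I N = (\<Sum>m<N. if m = n then of_nat (q n) else 0)"
      by (rule has_integral_unique)
    thus ?thesis by simp
  qed
  have "I \<longlonglongrightarrow> of_nat (q n)"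
    by (rule tendsto_eventually) (use eventually_gt_at_top[of n] in eventually_elim, simp add: I)
  with IJ(3) have "J = of_nat (q n)" by (rule LIMSEQ_unique)
  with IJ(2) show ?thesis by simp
qed

text \<open>Near x = 0 the transformation formula divides the main term by
  \<open>distinct_gf p\<close>; this measures the relative error. The constant is 1.12 / 0.941 <
  1.2.\<close>

lemma inverse_distinct_gf_minus_1_le:
  fixes p :: complex
  assumes "norm p \<le> 1 / 19"
  shows "norm (1 / distinct_gf p - 1) \<le> 1.2 * norm p"
proof -
  have ge: "norm (distinct_gf p) \<ge> 0.941" by (rule norm_distinct_gf_bounds) fact
  hence nz: "distinct_gf p \<noteq> 0" by auto
  have "norm (distinct_gf p - 1) \<le> distinct_gf (norm p) - 1"
    using assms by (intro norm_distinct_gf_minus_1_le) auto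
  also have "\<dots> \<le> 1.12 * norm p" using assms by (intro distinct_gf_minus_1_le) auto
  finally have le: "norm (distinct_gf p - 1) \<le> 1.12 * norm p" .
  have "1 / distinct_gf p - 1 = (1 - distinct_gf p) / distinct_gf p" using nz by (simp add: field_simps)
  hence "norm (1 / distinct_gf p - 1) = norm (distinct_gf p - 1) / norm (distinct_gf p)"
    by (simp add: norm_divide norm_minus_commute)
  also have "\<dots> \<le> 1.12 * norm p / 0.941"
    using ge le by (intro frac_le) auto
  also have "\<dots> \<le> 1.2 * norm p" by simp
  finally show ?thesis .
qed

text \<open>The last two terms are the contribution of the cusps \<open>\<plusminus>1/3\<close>. They have to be confined to short
  intervals: for \<open>\<nu>(n)\<close> close to 43 the bound would be too weak if they were present on the whole segment.\<close>

lemma weber_bound_strip: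
  assumes \<delta>: "0 < \<delta>" "\<delta> < 1 / 10" and x: "\<bar>x\<bar> \<le> 1 / 2" and far: "\<delta> / (x\<^sup>2 + \<delta>\<^sup>2) < 1"
  shows "weber (Complex (- x) \<delta>) \<le> 1.5 + 1.07 * exp (pi / (600 * \<delta>)) +
    (if x \<in> {1/3 - 4 * \<delta> / 3..1/3 + 4 * \<delta> / 3} then 1.07 * exp (pi / (216 * \<delta>)) else 0) +
    (if x \<in> {-1/3 - 4 * \<delta> / 3..-1/3 + 4 * \<delta> / 3} then 1.07 * exp (pi / (216 * \<delta>)) else 0)"
    (is "_ \<le> _ + ?J1 + ?J2")
proof -
  have nonneg: "?J1 \<ge> 0" "?J2 \<ge> 0" "1.07 * exp (pi / (600 * \<delta>)) \<ge> 0" by auto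
  consider "weber (Complex (- x) \<delta>) \<le> 1.5"
    | c d where "odd c" "coprime c d" "\<delta> / (cmod (of_int c * Complex (- x) \<delta> + of_int d))\<^sup>2 \<ge> 1"
     "weber (Complex (- x) \<delta>) \<le> 1.07 * exp (pi / 24 * (\<delta> / (cmod (of_int c * Complex (- x) \<delta> + of_int d))\<^sup>2))"
    using weber_bound[of "Complex (- x) \<delta>"] \<delta> by auto
  thus ?thesis
  proof cases
    case 1
    thus ?thesis using nonneg by linarith
  next
    case (2 c d)
    define v where "v = \<delta> / (cmod (of_int c * Complex (- x) \<delta> + of_int d))\<^sup>2"
    have N: "(cmod (of_int c * Complex (- x) \<delta> + of_int d))\<^sup>2 = (d - c * x)\<^sup>2 + (c * \<delta>)\<^sup>2"
      by (simp add: cmod_power2 algebra_simps)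
    have v_eq: "v = \<delta> / ((d - c * x)\<^sup>2 + (c * \<delta>)\<^sup>2)" unfolding v_def N ..
    have v1: "v \<ge> 1" and wv: "weber (Complex (- x) \<delta>) \<le> 1.07 * exp (pi / 24 * v)"
      using 2 by (auto simp: v_def)
    have c_pos: "c \<noteq> 0" using \<open>odd c\<close> by auto
    have v_le: "v \<le> 1 / (s * \<delta>)" if "s * \<delta>\<^sup>2 \<le> (d - c * x)\<^sup>2 + (c * \<delta>)\<^sup>2" "s > 0" for s
    proof -
      have "v \<le> \<delta> / (s * \<delta>\<^sup>2)"
        unfolding v_eq using that \<delta> by (intro divide_left_mono) (auto intro!: mult_pos_pos add_nonneg_pos simp: c_pos)
      thus ?thesis using \<delta> by (simp add: power2_eq_square)
    qed
    \<comment> \<open>The generic case, with 600 = 24 * 25. It covers |c| \<ge> 5, and |c| = 3 away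
      from the cusp.\<close>
    have bound25: ?thesis if "25 * \<delta>\<^sup>2 \<le> (d - c * x)\<^sup>2 + (c * \<delta>)\<^sup>2"
    proof -
      have "pi / 24 * v \<le> pi / 24 * (1 / (25 * \<delta>))"
        using v_le[OF that] by (intro mult_left_mono) auto
      hence "1.07 * exp (pi / 24 * v) \<le> 1.07 * exp (pi / (600 * \<delta>))" by simp
      thus ?thesis using wv nonneg by linarith
    qed
    \<comment> \<open>Denominator 1: among the integers 0 is nearest to x, so \<open>v\<close> would
      be at most \<delta> / (x^2 + \<delta>^2), which is below 1 by \<open>far\<close>.\<close>
    have "\<bar>c\<bar> \<noteq> 1"
    proof
      assume "\<bar>c\<bar> = 1"
      hence c2: "(real_of_int c)\<^sup>2 = 1" by (metis of_int_1 of_int_power power2_abs power_one)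
      have "\<bar>x\<bar> \<le> \<bar>d - c * x\<bar>"
      proof (cases "d = 0")
        case True
        thus ?thesis using \<open>\<bar>c\<bar> = 1\<close> by (simp add: abs_mult flip: of_int_abs)
      next
        case False
        hence "1 \<le> \<bar>real_of_int d\<bar>" by linarith
        moreover have "\<bar>c * x\<bar> = \<bar>x\<bar>" using \<open>\<bar>c\<bar> = 1\<close> by (simp add: abs_mult flip: of_int_abs)
        ultimately show ?thesis using x by linarith
      qed
      hence "x\<^sup>2 + \<delta>\<^sup>2 \<le> (d - c * x)\<^sup>2 + (c * \<delta>)\<^sup>2"
        by (simp add: power_mult_distrib c2 abs_le_square_iff)
      hence "v \<le> \<delta> / (x\<^sup>2 + \<delta>\<^sup>2)"
        unfolding v_eq using \<delta> by (intro divide_left_mono mult_pos_pos) (auto intro!: add_nonneg_pos simp: c_pos)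
      thus False using far v1 by linarith
    qed
    hence c3: "\<bar>c\<bar> \<ge> 3" using \<open>odd c\<close> c_pos by presburger
    show ?thesis
    \<comment> \<open>The threshold 4 \<delta> is chosen because 16 + 9 = 25: beyond it |c| = 3
      falls under \<open>bound25\<close>. Within it v \<le> 1 / (9 \<delta>), and 216 = 24 *
      9.\<close>
    proof (cases "\<bar>c\<bar> = 3 \<and> \<bar>d - c * x\<bar> \<le> 4 * \<delta>")
      case False
      show ?thesis
      proof (cases "\<bar>c\<bar> = 3")
        case True
        hence "c = 3 \<or> c = - 3" by linarith
        hence "(real_of_int c)\<^sup>2 = 9" by auto
        moreover have "\<bar>4 * \<delta>\<bar> \<le> \<bar>d - c * x\<bar>" using True False \<delta> by auto
        hence "(4 * \<delta>)\<^sup>2 \<le> (d - c * x)\<^sup>2" by (simp only: abs_le_square_iff)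
        ultimately show ?thesis by (intro bound25) (simp add: power_mult_distrib)
      next
        case False
        hence "\<bar>c\<bar> \<ge> 5" using c3 \<open>odd c\<close> by presburger
        hence "\<bar>5\<bar> \<le> \<bar>real_of_int c\<bar>" by linarith
        hence "5\<^sup>2 \<le> (real_of_int c)\<^sup>2" by (simp only: abs_le_square_iff)
        hence "25 * \<delta>\<^sup>2 \<le> (real_of_int c)\<^sup>2 * \<delta>\<^sup>2" by (intro mult_right_mono) auto
        thus ?thesis by (intro bound25) (simp add: power_mult_distrib add_increasing)
      qed
    next
      case True
      hence c: "c = 3 \<or> c = - 3" and near: "\<bar>d - c * x\<bar> \<le> 4 * \<delta>" by auto
      have "\<bar>c * x\<bar> \<le> 3 / 2" using c x by auto
      hence "\<bar>real_of_int d\<bar> < 2" using near \<delta> by linarith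
      moreover have "d \<noteq> 0" using \<open>coprime c d\<close> c by auto
      ultimately have d: "d = 1 \<or> d = -1" by linarith
      have "(real_of_int c)\<^sup>2 = 9" using c by auto
      hence "9 * \<delta>\<^sup>2 \<le> (d - c * x)\<^sup>2 + (c * \<delta>)\<^sup>2" by (simp add: power_mult_distrib)
      from v_le[OF this] have "pi / 24 * v \<le> pi / 24 * (1 / (9 * \<delta>))"
        by (intro mult_left_mono) auto
      hence "1.07 * exp (pi / 24 * v) \<le> 1.07 * exp (pi / (216 * \<delta>))" by simp
      moreover have "x \<in> {1/3 - 4 * \<delta> / 3..1/3 + 4 * \<delta> / 3} \<or> x \<in> {-1/3 - 4 * \<delta> / 3..-1/3 + 4 * \<delta> / 3}"
        using c d near by auto
      hence "?J1 + ?J2 \<ge> 1.07 * exp (pi / (216 * \<delta>))" by auto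
      ultimately show ?thesis using wv nonneg by linarith
    qed
  qed
qed

section \<open>Numerical comparison of error and main term\<close>

lemma exp_quarter_power_le: "(41 / 32 :: real) ^ k \<le> exp (real k / 4)"
proof -
  have "(41 / 32 :: real) ^ k \<le> exp (1 / 4) ^ k"
    using exp_lower_Taylor_quadratic[of "1 / 4"] by (intro power_mono) (auto simp: power2_eq_square)
  thus ?thesis by (simp flip: exp_of_nat_mult)
qed

text \<open>The error has order exp(s/3), so a margin exp(2s/3) remains for the power s^7.5. The
  threshold 43 enters through the exponential bounds \<open>e1\<close>, \<open>e2\<close>,
  \<open>e3\<close>, which hold at 43 by a power of 41/32 and persist beyond.\<close>

lemma error_le_main_term:
  fixes s :: real
  assumes "s \<ge> 43"
  shows "(5 + 1.07 * exp (0.06 * s) + 0.0117 * exp (s / 6)) * exp (s / 6) * (sqrt s * s ^ 7) \<le> 0.114 * exp s"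
proof -
  have e1: "exp (0.06 * s) \<ge> 11.2"
  proof -
    have "11.2 \<le> (41 / 32 :: real) ^ 10" by (simp add: power_divide)
    also have "\<dots> \<le> exp (real 10 / 4)" by (rule exp_quarter_power_le)
    also have "\<dots> \<le> exp (0.06 * s)" using assms by simp
    finally show ?thesis .
  qed
  have e2: "80 * exp (0.06 * s) \<le> exp (s / 6)"
  proof -
    have "80 \<le> (41 / 32 :: real) ^ 18" by (simp add: power_divide)
    also have "\<dots> \<le> exp (real 18 / 4)" by (rule exp_quarter_power_le)
    also have "\<dots> \<le> exp (s / 6 - 0.06 * s)" using assms by simp
    finally have "80 * exp (0.06 * s) \<le> exp (s / 6 - 0.06 * s) * exp (0.06 * s)" by simp
    thus ?thesis by (simp flip: exp_add)
  qed
  \<comment> \<open>The tangent of exp at 43/12, with exp(43/12) \<ge> 32 and 1.4 * 32 > 43.\<close>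
  have e3: "s \<le> 1.4 * exp (s / 12)"
  proof -
    have "32 \<le> (41 / 32 :: real) ^ 14" by (simp add: power_divide)
    also have "\<dots> \<le> exp (real 14 / 4)" by (rule exp_quarter_power_le)
    also have "\<dots> \<le> exp (43 / 12)" by simp
    finally have "32 * (1 + (s - 43) / 12) \<le> exp (43 / 12) * exp ((s - 43) / 12)"
      using assms by (intro mult_mono exp_ge_add_one_self) auto
    also have "\<dots> = exp (s / 12)" by (simp flip: exp_add add: field_simps)
    finally have "1.4 * (32 * (1 + (s - 43) / 12)) \<le> 1.4 * exp (s / 12)"
      by (rule mult_left_mono) simp
    moreover have "s \<le> 1.4 * (32 * (1 + (s - 43) / 12))" using assms by (simp add: field_simps)
    ultimately show ?thesis by (rule order_trans[rotated])
  qed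
  have "s ^ 8 \<le> (1.4 * exp (s / 12)) ^ 8" using e3 assms by (intro power_mono) auto
  also have "\<dots> = 1.4 ^ 8 * exp (2 * s / 3)"
    by (simp only: power_mult_distrib exp_of_nat_mult[symmetric]) simp
  also have "\<dots> \<le> 14.8 * exp (2 * s / 3)" by (intro mult_right_mono) (auto simp: power_divide)
  finally have s8: "s ^ 8 \<le> 14.8 * exp (2 * s / 3)" .
  have "sqrt (6.5\<^sup>2) \<le> sqrt s" using assms by (intro real_sqrt_le_mono) (simp add: power2_eq_square)
  hence "6.5 \<le> sqrt s" by simp
  hence "6.5 * sqrt s \<le> sqrt s * sqrt s" using assms by (intro mult_right_mono) auto
  hence "sqrt s \<le> s / 6.5" using assms by simp
  hence "sqrt s * s ^ 7 \<le> s / 6.5 * s ^ 7" using assms by (intro mult_right_mono) auto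
  also have "\<dots> = s ^ 8 / 6.5" by (simp add: eval_nat_numeral)
  also have "\<dots> \<le> 14.8 * exp (2 * s / 3) / 6.5" using s8 by (rule divide_right_mono) simp
  also have "\<dots> \<le> 2.3 * exp (2 * s / 3)" by simp
  finally have pow: "sqrt s * s ^ 7 \<le> 2.3 * exp (2 * s / 3)" .
  \<comment> \<open>5/11.2 + 1.07 < 1.52 copies of exp(0.06 s), each at most exp(s/6)/80, and
    1.52/80 + 0.0117 < 0.031.\<close>
  have "5 + 1.07 * exp (0.06 * s) + 0.0117 * exp (s / 6) \<le> 0.031 * exp (s / 6)"
    using e1 e2 by simp
  hence "(5 + 1.07 * exp (0.06 * s) + 0.0117 * exp (s / 6)) * exp (s / 6) \<le>
         0.031 * exp (s / 6) * exp (s / 6)"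
    by (rule mult_right_mono) simp
  hence "(5 + 1.07 * exp (0.06 * s) + 0.0117 * exp (s / 6)) * exp (s / 6) * (sqrt s * s ^ 7) \<le>
         0.031 * exp (s / 6) * exp (s / 6) * (2.3 * exp (2 * s / 3))"
    using pow by (rule mult_mono) (use assms in auto)
  also have "\<dots> = 0.0713 * exp s" by (simp flip: exp_add)
  also have "\<dots> \<le> 0.114 * exp s" by simp
  finally show ?thesis .
qed

section \<open>The error of the approximation along the segment\<close>

lemma distinct_gf_error_bound:
  fixes \<delta> x :: real and z :: complex
  assumes \<delta>: "0 < \<delta>" "\<delta> < 1 / 10" and x: "\<bar>x\<bar> \<le> 1 / 2"
  defines "z \<equiv> Complex \<delta> x"
  shows "norm (sqrt 2 * exp (- pi * z / 12) * distinct_gf (exp (- 2 * pi * z)) - exp (pi / 24 / z)) \<le>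
     3 + 1.07 * exp (pi / (600 * \<delta>)) +
    (if x \<in> {1/3 - 4 * \<delta> / 3..1/3 + 4 * \<delta> / 3} then 1.07 * exp (pi / (216 * \<delta>)) else 0) +
    (if x \<in> {-1/3 - 4 * \<delta> / 3..-1/3 + 4 * \<delta> / 3} then 1.07 * exp (pi / (216 * \<delta>)) else 0)"
    (is "norm (?f - ?g) \<le> _ + ?J1 + ?J2")
proof -
  have nonneg: "?J1 \<ge> 0" "?J2 \<ge> 0" "1.07 * exp (pi / (600 * \<delta>)) \<ge> 0" by auto
  have z: "Re z > 0" "z \<noteq> 0" using \<delta> by (auto simp: z_def complex_eq_iff)
  define y where "y = \<delta> / (x\<^sup>2 + \<delta>\<^sup>2)"
  have Re_inv: "Re (of_real r / z) = r * y" for r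
    by (simp add: z_def y_def Re_divide add.commute)
  have norm_g: "norm ?g = exp (pi / 24 * y)"
    using Re_inv[of "pi / 24"] by simp
  show ?thesis
  proof (cases "y < 1")
    case True
    define \<tau> where "\<tau> = Complex (- x) \<delta>"
    have "2 * pi * \<i> * \<tau> = - 2 * pi * z" by (simp add: \<tau>_def z_def complex_eq_iff)
    hence ex: "exp (2 * pi * \<i> * \<tau>) = exp (- 2 * pi * z)" by (rule arg_cong)
    have "norm ?f = weber \<tau>"
      unfolding weber_def ex by (simp add: norm_mult) (simp add: \<tau>_def z_def)
    hence f: "norm ?f \<le> 1.5 + 1.07 * exp (pi / (600 * \<delta>)) + ?J1 + ?J2"
      using weber_bound_strip[OF \<delta> x] True by (simp only: y_def \<tau>_def)
    have "pi / 24 * y \<le> 3.2 / 24 * 1"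
      using True pi_approx \<delta> by (intro mult_mono) (auto simp: y_def)
    hence "norm ?g \<le> exp (2 / 15)" unfolding norm_g by simp
    also have "\<dots> \<le> 1 + 2 / 15 + (2 / 15)\<^sup>2" by (rule exp_bound) auto
    also have "\<dots> \<le> 1.5" by (simp add: power2_eq_square)
    finally have "norm ?g \<le> 1.5" .
    thus ?thesis using f norm_triangle_ineq4[of ?f ?g] by linarith
  next
    case False
    define p where "p = exp (- pi / z)"
    have norm_p: "norm p = exp (- pi * y)"
      using Re_inv[of "- pi"] by (simp add: p_def)
    have "norm p \<le> exp (- pi)" unfolding norm_p using False by simp
    hence p: "norm p \<le> 1 / 19" using exp_minus_pi_le by linarith
    hence "norm (distinct_gf p) \<ge> 0.941" by (rule norm_distinct_gf_bounds)
    hence nz: "distinct_gf p \<noteq> 0" by auto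
    have "?f * distinct_gf p = sqrt 2 * exp (- pi * z / 12) * (distinct_gf (exp (- 2 * pi * z)) * distinct_gf p)"
      by (simp only: mult_ac)
    also have "\<dots> = sqrt 2 * exp (- pi * z / 12) * (exp (pi / (24 * z) + pi * z / 12) / sqrt 2)"
      unfolding p_def using distinct_gf_transformation[OF z(1)] by (simp only:)
    also have "\<dots> = exp (- pi * z / 12) * exp (pi / (24 * z) + pi * z / 12)"
      by (simp add: complex_eq_iff)
    also have "\<dots> = ?g" by (simp flip: exp_add)
    finally have "?f - ?g = ?g * (1 / distinct_gf p - 1)"
      using nz by (simp add: field_simps)
    hence "norm (?f - ?g) = norm ?g * norm (1 / distinct_gf p - 1)"
      by (simp only: norm_mult)
    also have "\<dots> \<le> exp (pi / 24 * y) * (1.2 * norm p)"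
      unfolding norm_g using p by (intro mult_left_mono inverse_distinct_gf_minus_1_le) auto
    also have "\<dots> = 1.2 * exp (pi / 24 * y - pi * y)"
      unfolding norm_p by (simp flip: exp_add)
    also have "\<dots> \<le> 1.2 * 1"
      using False by (intro mult_left_mono) auto
    finally show ?thesis using nonneg by linarith
  qed
qed

text \<open>Each window around \<plusminus>1/3 has length 8 \<delta> / 3, whence the factor 16
  \<delta> / 3; \<delta> < 1/10 keeps both inside the segment.\<close>

lemma integral_error_bound:
  fixes \<delta> \<mu> :: real
  assumes \<delta>: "0 < \<delta>" "\<delta> < 1 / 10"
  shows "norm (integral {-1/2..1/2} (\<lambda>x. (sqrt 2 * exp (- pi * Complex \<delta> x / 12) *
       distinct_gf (exp (- 2 * pi * Complex \<delta> x)) - exp (pi / 24 / Complex \<delta> x)) * exp (\<mu> * Complex \<delta> x)))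
     \<le> (3 + 1.07 * exp (pi / (600 * \<delta>)) + 16 * \<delta> / 3 * (1.07 * exp (pi / (216 * \<delta>)))) * exp (\<mu> * \<delta>)"
    (is "norm (integral _ (\<lambda>x. ?f x * ?e x)) \<le> _")
proof -
  define B where "B = 3 + 1.07 * exp (pi / (600 * \<delta>))"
  define K where "K = 1.07 * exp (pi / (216 * \<delta>))"
  define J1 where "J1 = {1/3 - 4 * \<delta> / 3..1/3 + 4 * \<delta> / 3}"
  define J2 where "J2 = {-1/3 - 4 * \<delta> / 3..-1/3 + 4 * \<delta> / 3}"
  have J: "J1 \<subseteq> {-1/2..1/2}" "J2 \<subseteq> {-1/2..1/2}" using \<delta> by (auto simp: J1_def J2_def)
  have "((\<lambda>x. K) has_integral (8 * \<delta> / 3 * K)) J1" "((\<lambda>x. K) has_integral (8 * \<delta> / 3 * K)) J2"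
    using has_integral_const_real[of K "1/3 - 4 * \<delta> / 3" "1/3 + 4 * \<delta> / 3"]
          has_integral_const_real[of K "-1/3 - 4 * \<delta> / 3" "-1/3 + 4 * \<delta> / 3"] \<delta>
    by (simp_all add: J1_def J2_def)
  hence "((\<lambda>x. if x \<in> J1 then K else 0) has_integral (8 * \<delta> / 3 * K)) {-1/2..1/2}"
        "((\<lambda>x. if x \<in> J2 then K else 0) has_integral (8 * \<delta> / 3 * K)) {-1/2..1/2}"
    using J by (simp_all add: has_integral_restrict)
  moreover have "((\<lambda>x. B) has_integral B) {-1/2..1/2::real}"
    using has_integral_const_real[of B "-1/2" "1/2"] by simp
  ultimately have "((\<lambda>x. (B + (if x \<in> J1 then K else 0) + (if x \<in> J2 then K else 0)) * exp (\<mu> * \<delta>)) has_integral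
      (B + 8 * \<delta> / 3 * K + 8 * \<delta> / 3 * K) * exp (\<mu> * \<delta>)) {-1/2..1/2}"
    by (intro has_integral_mult_left has_integral_add)
  hence bound: "((\<lambda>x. (B + (if x \<in> J1 then K else 0) + (if x \<in> J2 then K else 0)) * exp (\<mu> * \<delta>)) has_integral
      (B + 16 * \<delta> / 3 * K) * exp (\<mu> * \<delta>)) {-1/2..1/2}"
    by (simp add: algebra_simps)
  have "norm (integral {-1/2..1/2} (\<lambda>x. ?f x * ?e x)) \<le>
        integral {-1/2..1/2} (\<lambda>x. (B + (if x \<in> J1 then K else 0) + (if x \<in> J2 then K else 0)) * exp (\<mu> * \<delta>))"
  proof (rule integral_norm_bound_integral)
    have nz: "Complex \<delta> x \<noteq> 0" for x using \<delta> by (simp add: complex_eq_iff)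
    have cz: "continuous_on A (\<lambda>x. Complex \<delta> x)" for A
      unfolding Complex_eq by (intro continuous_intros)
    have "continuous_on {-1/2..1/2} (\<lambda>x. distinct_gf (exp (- 2 * pi * Complex \<delta> x)))"
      by (rule continuous_on_compose2[OF holomorphic_on_imp_continuous_on[OF holomorphic_distinct_gf]])
         (use \<delta> in \<open>auto intro!: continuous_intros cz\<close>)
    hence "continuous_on {-1/2..1/2} (\<lambda>x. ?f x * ?e x)"
      using nz by (intro continuous_intros cz) auto
    thus "(\<lambda>x. ?f x * ?e x) integrable_on {-1/2..1/2}" by (rule integrable_continuous_real)
    show "(\<lambda>x. (B + (if x \<in> J1 then K else 0) + (if x \<in> J2 then K else 0)) * exp (\<mu> * \<delta>)) integrable_on {-1/2..1/2}"
      using bound by (rule has_integral_integrable)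
    fix x :: real assume "x \<in> {-1/2..1/2}"
    hence "\<bar>x\<bar> \<le> 1 / 2" by auto
    from distinct_gf_error_bound[OF \<delta> this]
    have "norm (?f x) \<le> B + (if x \<in> J1 then K else 0) + (if x \<in> J2 then K else 0)"
      by (simp only: B_def K_def J1_def J2_def)
    moreover have "norm (?e x) = exp (\<mu> * \<delta>)" by simp
    ultimately show "norm (?f x * ?e x) \<le> (B + (if x \<in> J1 then K else 0) + (if x \<in> J2 then K else 0)) * exp (\<mu> * \<delta>)"
      unfolding norm_mult by (simp only:) (intro mult_right_mono, auto)
  qed
  also have "\<dots> = (B + 16 * \<delta> / 3 * K) * exp (\<mu> * \<delta>)"
    using bound by (rule integral_unique)
  finally show ?thesis by (simp only: B_def K_def)
qed

lemma sqrt2_times_M: "sqrt 2 * M n = pi * pi / (6 * nu n) * bessel_I1 (nu n)"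
proof -
  have "sqrt 2 * M n = (sqrt 2 * sqrt 2) * (pi * pi) / (12 * nu n) * bessel_I1 (nu n)"
    by (simp only: M_def power2_eq_square times_divide_eq_right times_divide_eq_left mult.assoc)
  thus ?thesis by simp
qed

text \<open>The normalising factor exp(-\<pi> z / 12) turns n into n + 1/24, whence
  \<open>\<mu>\<close>. The contour estimate with a = \<pi>/24 and b = \<mu>, for which 2 sqrt(ab) =
  \<nu>(n), contributes the second summand.\<close>

lemma q_minus_M_bound:
  assumes "nu n > 0" "0 < \<delta>" "\<delta> < 1 / 10"
  defines "\<mu> \<equiv> 2 * pi * (real n + 1 / 24)"
  shows "sqrt 2 * \<bar>real (q n) - M n\<bar> \<le>
     (3 + 1.07 * exp (pi / (600 * \<delta>)) + 16 * \<delta> / 3 * (1.07 * exp (pi / (216 * \<delta>)))) * exp (\<mu> * \<delta>) +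
     (1 + 4 * \<delta> * exp (\<mu> * \<delta> + pi / 6 * \<delta>))"
proof -
  define f g e where "f = (\<lambda>x. sqrt 2 * exp (- pi * Complex \<delta> x / 12) * distinct_gf (exp (- 2 * pi * Complex \<delta> x)))"
    and "g = (\<lambda>x. exp (pi / 24 / Complex \<delta> x))" and "e = (\<lambda>x. exp (\<mu> * Complex \<delta> x))"
  have \<mu>: "\<mu> > 0" by (auto simp: \<mu>_def intro!: mult_pos_pos add_nonneg_pos)
  have nz: "Complex \<delta> x \<noteq> 0" for x using assms by (simp add: complex_eq_iff)
  have "((\<lambda>x. sqrt 2 * (distinct_gf (exp (-2 * pi * Complex \<delta> x)) * exp (2 * pi * n * Complex \<delta> x))) has_integral
           of_real (sqrt 2) * of_nat (q n)) {-1/2..1/2}"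
    using assms by (intro has_integral_mult_right has_integral_q)
  also have "(\<lambda>x. sqrt 2 * (distinct_gf (exp (-2 * pi * Complex \<delta> x)) * exp (2 * pi * n * Complex \<delta> x))) = (\<lambda>x. f x * e x)"
  proof
    fix x
    have "2 * pi * n * Complex \<delta> x = - pi * Complex \<delta> x / 12 + \<mu> * Complex \<delta> x"
      by (simp add: \<mu>_def algebra_simps)
    hence "exp (2 * pi * n * Complex \<delta> x) = exp (- pi * Complex \<delta> x / 12) * e x"
      by (simp only: e_def exp_add)
    thus "sqrt 2 * (distinct_gf (exp (-2 * pi * Complex \<delta> x)) * exp (2 * pi * n * Complex \<delta> x)) = f x * e x"
      by (simp only: f_def mult_ac)
  qed
  finally have fe: "((\<lambda>x. f x * e x) has_integral of_real (sqrt 2) * of_nat (q n)) {-1/2..1/2}" .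
  have ge_eq: "g x * e x = exp ((pi / 24) / Complex \<delta> x + \<mu> * Complex \<delta> x)" for x
    by (simp only: g_def e_def exp_add)
  have "continuous_on {-1/2..1/2} (\<lambda>x. g x * e x)"
    unfolding g_def e_def Complex_eq using nz[unfolded Complex_eq] by (intro continuous_intros) auto
  hence ge: "((\<lambda>x. g x * e x) has_integral integral {-1/2..1/2} (\<lambda>x. g x * e x)) {-1/2..1/2}"
    by (intro integrable_integral integrable_continuous_real)
  have nu2: "(nu n)\<^sup>2 = pi * \<mu> / 6"
    by (simp add: nu_def \<mu>_def power_divide power_mult_distrib) (simp add: power2_eq_square field_simps)
  have s1: "2 * sqrt (pi / 24 * \<mu>) = nu n"
  proof (rule power2_eq_imp_eq)
    show "(2 * sqrt (pi / 24 * \<mu>))\<^sup>2 = (nu n)\<^sup>2" using \<mu> by (simp add: nu2 power_mult_distrib)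
  qed (use \<mu> assms in auto)
  have s2: "sqrt (pi / 24 / \<mu>) = pi / (12 * nu n)"
  proof (rule power2_eq_imp_eq)
    show "(sqrt (pi / 24 / \<mu>))\<^sup>2 = (pi / (12 * nu n))\<^sup>2"
      using \<mu> by (simp add: power_divide power_mult_distrib nu2) (simp add: power2_eq_square field_simps)
  qed (use \<mu> assms in auto)
  have "2 * pi * sqrt (pi / 24 / \<mu>) * bessel_I1 (2 * sqrt (pi / 24 * \<mu>)) = sqrt 2 * M n"
    unfolding s1 s2 sqrt2_times_M by simp
  hence main: "norm (integral {-1/2..1/2} (\<lambda>x. g x * e x) - of_real (sqrt 2 * M n)) \<le>
               1 + 4 * \<delta> * exp (\<mu> * \<delta> + pi / 6 * \<delta>)"
    using integral_vertical_segment_bessel[of "pi / 24" \<mu> \<delta>] \<mu> assms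
    unfolding ge_eq by simp
  have "integral {-1/2..1/2} (\<lambda>x. (f x - g x) * e x) =
        of_real (sqrt 2) * of_nat (q n) - integral {-1/2..1/2} (\<lambda>x. g x * e x)"
    using has_integral_diff[OF fe ge] by (intro integral_unique) (simp add: algebra_simps)
  hence "complex_of_real (sqrt 2 * (real (q n) - M n)) =
     integral {-1/2..1/2} (\<lambda>x. (f x - g x) * e x) +
     (integral {-1/2..1/2} (\<lambda>x. g x * e x) - of_real (sqrt 2 * M n))"
    by (simp add: algebra_simps)
  hence "norm (complex_of_real (sqrt 2 * (real (q n) - M n))) \<le>
     norm (integral {-1/2..1/2} (\<lambda>x. (f x - g x) * e x)) +
     norm (integral {-1/2..1/2} (\<lambda>x. g x * e x) - of_real (sqrt 2 * M n))"
    by (simp only: norm_triangle_ineq)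
  also have "norm (complex_of_real (sqrt 2 * (real (q n) - M n))) = sqrt 2 * \<bar>real (q n) - M n\<bar>"
    by (simp only: norm_of_real abs_mult) simp
  finally show ?thesis
    using integral_error_bound[OF assms(2,3), of \<mu>] main unfolding f_def g_def e_def by linarith
qed

theorem theorem1p3:
  fixes n :: nat
  assumes "0 < n" and "43 \<le> nu n"
  shows "M n * (1 - 1 / nu n ^ 6) \<le> real (q n) \<and> real (q n) \<le> M n * (1 + 1 / nu n ^ 6)"
proof -
  define s where "s = nu n"
  have s: "s \<ge> 43" using assms by (simp add: s_def)
  \<comment> \<open>This choice balances the growth \<open>exp (\<mu> \<delta>)\<close> against \<open>exp (\<pi> / (216 \<delta>))\<close> at the cusps \<open>\<plusminus>1/3\<close>:
    both are \<open>exp (s / 6)\<close>.\<close>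
  define \<delta> where "\<delta> = pi / (36 * s)"
  define \<mu> where "\<mu> = 2 * pi * (real n + 1 / 24)"
  have \<delta>_le: "\<delta> \<le> 3.142 / (36 * 43)"
    unfolding \<delta>_def using s pi_approx by (intro frac_le) auto
  have \<delta>: "0 < \<delta>" "\<delta> < 1 / 10" using s \<delta>_le by (simp add: \<delta>_def, simp)
  have e1: "pi / (600 * \<delta>) = 0.06 * s" "pi / (216 * \<delta>) = s / 6"
    using s by (auto simp: \<delta>_def)
  have "s\<^sup>2 = pi * \<mu> / 6"
    by (simp add: s_def nu_def \<mu>_def power_divide power_mult_distrib) (simp add: power2_eq_square field_simps)
  hence e2: "\<mu> * \<delta> = s / 6"
    using s by (simp add: \<delta>_def power2_eq_square field_simps)
  \<comment> \<open>16/3 * 1.07 * 3.142 / (36 * 43) < 0.0117.\<close>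
  have c1: "16 * \<delta> / 3 * (1.07 * exp (s / 6)) \<le> 0.0117 * exp (s / 6)"
    using \<delta>_le by simp
  have c2: "1 \<le> exp (s / 6)" using s by simp
  have c3: "4 * \<delta> * exp (s / 6 + pi / 6 * \<delta>) \<le> exp (s / 6)"
  proof -
    have "pi / 6 * \<delta> \<le> 1 * 1" using pi_approx \<delta> by (intro mult_mono) auto
    hence "exp (pi / 6 * \<delta>) \<le> exp 1" by simp
    hence "exp (pi / 6 * \<delta>) \<le> 3" using exp_le by linarith
    hence "4 * \<delta> * exp (pi / 6 * \<delta>) \<le> (4 * (3.142 / (36 * 43))) * 3"
      using \<delta> \<delta>_le by (intro mult_mono) auto
    also have "\<dots> \<le> 1" by simp
    finally have "exp (s / 6) * (4 * \<delta> * exp (pi / 6 * \<delta>)) \<le> exp (s / 6) * 1"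
      by (intro mult_left_mono) auto
    thus ?thesis by (simp add: exp_add mult_ac)
  qed
  have "sqrt 2 * \<bar>real (q n) - M n\<bar> \<le>
     (3 + 1.07 * exp (0.06 * s) + 16 * \<delta> / 3 * (1.07 * exp (s / 6))) * exp (s / 6) +
     (1 + 4 * \<delta> * exp (s / 6 + pi / 6 * \<delta>))"
    using q_minus_M_bound[of n \<delta>] s \<delta> unfolding e1 \<mu>_def[symmetric] e2 s_def by simp
  \<comment> \<open>The two terms of the contour error are each absorbed by one exp(s/6), which
    turns 3 into 5.\<close>
  also have "\<dots> \<le> (3 + 1.07 * exp (0.06 * s) + 0.0117 * exp (s / 6)) * exp (s / 6) +
     (exp (s / 6) + exp (s / 6))"
    using c1 c2 c3 by (intro add_mono mult_right_mono) auto
  also have "\<dots> = (5 + 1.07 * exp (0.06 * s) + 0.0117 * exp (s / 6)) * exp (s / 6)"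
    by (simp add: algebra_simps)
  also have "\<dots> \<le> 0.114 * exp s / (sqrt s * s ^ 7)"
    using error_le_main_term[OF s] s by (subst pos_le_divide_eq) auto
  also have "\<dots> \<le> sqrt 2 * (M n / s ^ 6)"
  proof -
    have "3.14 * 3.14 \<le> pi * pi" using pi_approx by (intro mult_mono) auto
    \<comment> \<open>3.14^2 * 0.07 / 6 > 0.114, where 0.07 is the constant of the Bessel
      bound.\<close>
    hence "0.114 \<le> 2 * (pi * pi) / 12 * 0.07" by simp
    hence "0.114 * (exp s / sqrt s) \<le> 2 * (pi * pi) / 12 * 0.07 * (exp s / sqrt s)"
      using s by (intro mult_right_mono) auto
    also have "\<dots> = 2 * (pi * pi) / 12 * (0.07 * exp s / sqrt s)" by simp
    also have "\<dots> \<le> 2 * (pi * pi) / 12 * bessel_I1 s"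
      using s by (intro mult_left_mono bessel_I1_lower_bound) auto
    finally have "0.114 * (exp s / sqrt s) / s ^ 7 \<le> 2 * (pi * pi) / 12 * bessel_I1 s / s ^ 7"
      using s by (intro divide_right_mono) auto
    also have "\<dots> = sqrt 2 * (M n / s ^ 6)"
    proof -
      have "s ^ 7 = s * s ^ 6" by (simp add: eval_nat_numeral)
      thus ?thesis unfolding times_divide_eq_right sqrt2_times_M s_def[symmetric] by simp
    qed
    finally show ?thesis by simp
  qed
  finally have "\<bar>real (q n) - M n\<bar> \<le> M n / s ^ 6"
    by (rule mult_left_le_imp_le) simp
  thus ?thesis unfolding s_def abs_le_iff by (simp add: algebra_simps)
qed

end
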